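(* Let $H_0,H_I$ be Hermitian operators on a finite-dimensional Hilbert space and $\beta>0$. Then for every $k\ge1$, $$\mathcal{M}_k(\beta)=(-1)^k\sum_{\omega_1,\dots,\omega_{k-1}}g_k(\beta;\omega_1,\dots,\omega_{k-1})\,D_{\omega_1}\cdots D_{\omega_{k-1}}D_{-\omega_1-\dots-\omega_{k-1}},$$ the sum running over Bohr frequencies $\omega_1,\dots,\omega_{k-1}$ of $H_0$, where, writing $s_l=\sum_{j=1}^l\omega_j$, $$g_k(\beta;\omega_1,\dots,\omega_{k-1})=\frac{1}{\prod_{l=1}^{k-1}s_l}\Big(\beta-\sum_{l=1}^{k-1}\frac1{s_l}\Big)-\sum_{p=1}^{k-1}\frac{(-1)^p e^{-\beta s_p}}{\Big(\prod_{m=2}^p\sum_{i=m}^p\omega_i\Big)s_p^2\Big(\prod_{l=p+1}^{k-1}\sum_{j=p+1}^l\omega_j\Big)}$$ (empty products equal $1$), and for frequency tuples for which some denominator vanishes, $g_k$ is understood as the limit (continuous extension) of this expression. In particular $\mathcal{M}_1(\beta)=-\beta D_0$.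
   Context: $H_0=\sum_\varepsilon\varepsilon\Pi_\varepsilon$ is the spectral decomposition of $H_0$ (distinct eigenvalues, orthogonal spectral projectors). $\mathcal{P}X=\sum_\varepsilon\Pi_\varepsilon X\Pi_\varepsilon$ (equivalently the long-time average $\lim_{T\to\infty}\frac1T\int_0^Te^{iH_0t}Xe^{-iH_0t}dt$). Bohr frequencies are the differences $\varepsilon'-\varepsilon$ of eigenvalues of $H_0$ (eigenvalues of $[H_0,\cdot]$ up to sign). For real $\nu$ set $D_\nu=\sum_{\varepsilon,\varepsilon':\,\varepsilon'-\varepsilon=\nu}\Pi_\varepsilon H_I\Pi_{\varepsilon'}$ (zero if $\nu$ is not a Bohr frequency), so $H_I=\sum_\omega D_\omega$, $[H_0,D_\omega]=-\omega D_\omega$, $D_{-\omega}=D_\omega^\dagger$. $\mathcal{M}_k(\beta)=(-1)^k\int_0^\beta d\beta_1\int_0^{\beta_1}d\beta_2\cdots\int_0^{\beta_{k-1}}d\beta_k\,\mathcal{P}(H_I(\beta_1)\cdots H_I(\beta_k))$ with $H_I(s)=e^{sH_0}H_Ie^{-sH_0}$. *)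

theory Defs
  imports "HOL-Analysis.Analysis"
begin

type_synonym 'n cmat = "complex ^'n ^'n"

(* conjugate transpose *)
definition cadj :: "'n::finite cmat \<Rightarrow> 'n cmat" where
  "cadj A = (\<chi> i j. cnj (A $ j $ i))"

definition hermitian :: "'n::finite cmat \<Rightarrow> bool" where
  "hermitian A \<longleftrightarrow> cadj A = A"

(* matrix power and matrix exponential (power series) *)
definition mpow :: "'n::finite cmat \<Rightarrow> nat \<Rightarrow> 'n cmat" where
  "mpow A n = (((**) A) ^^ n) (mat 1)"

definition mexp :: "'n::finite cmat \<Rightarrow> 'n cmat" where
  "mexp A = (\<Sum>n. (1 / fact n) *\<^sub>R mpow A n)"

(* ordered product of a list of matrices *)
definition mprod :: "'n::finite cmat list \<Rightarrow> 'n cmat" where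
  "mprod xs = foldr (**) xs (mat 1)"

(* eigenvalues (real, as H0 is Hermitian) *)
definition eigvals :: "'n::finite cmat \<Rightarrow> real set" where
  "eigvals H = {e. \<exists>v. v \<noteq> 0 \<and> H *v v = complex_of_real e *s v}"

definition eigspace :: "'n::finite cmat \<Rightarrow> real \<Rightarrow> (complex ^'n) set" where
  "eigspace H e = {v. H *v v = complex_of_real e *s v}"

(* orthogonal spectral projector onto the eigenspace *)
definition specproj :: "'n::finite cmat \<Rightarrow> real \<Rightarrow> 'n cmat" where
  "specproj H e = (THE P. P ** P = P \<and> cadj P = P \<and> range ((*v) P) = eigspace H e)"

(* pinching / dephasing map  P X = sum_e Pi_e X Pi_e *)
definition pinch :: "'n::finite cmat \<Rightarrow> 'n cmat \<Rightarrow> 'n cmat" where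
  "pinch H X = (\<Sum>e\<in>eigvals H. specproj H e ** X ** specproj H e)"

definition bohr :: "'n::finite cmat \<Rightarrow> real set" where
  "bohr H = {e' - e | e e'. e \<in> eigvals H \<and> e' \<in> eigvals H}"

(* D_nu = sum_{e'-e = nu} Pi_e H_I Pi_e' *)
definition Dop :: "'n::finite cmat \<Rightarrow> 'n cmat \<Rightarrow> real \<Rightarrow> 'n cmat" where
  "Dop H0 HI nu = (\<Sum>(e, e')\<in>{(e, e'). e \<in> eigvals H0 \<and> e' \<in> eigvals H0 \<and> e' - e = nu}.
                     specproj H0 e ** HI ** specproj H0 e')"

(* imaginary-time evolved interaction  H_I(s) = e^{s H0} H_I e^{-s H0} *)
definition HIt :: "'n::finite cmat \<Rightarrow> 'n cmat \<Rightarrow> real \<Rightarrow> 'n cmat" where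
  "HIt H0 HI s = mexp (s *\<^sub>R H0) ** HI ** mexp ((- s) *\<^sub>R H0)"

(* nested integral  int_0^b dt1 int_0^t1 dt2 ... int_0^{t_{k-1}} dtk  f [t1,...,tk] *)
fun nested_int :: "nat \<Rightarrow> real \<Rightarrow> (real list \<Rightarrow> 'a::euclidean_space) \<Rightarrow> 'a" where
  "nested_int 0 b f = f []"
| "nested_int (Suc m) b f = integral {0..b} (\<lambda>t. nested_int m t (\<lambda>ts. f (t # ts)))"

definition Mk :: "'n::finite cmat \<Rightarrow> 'n cmat \<Rightarrow> nat \<Rightarrow> real \<Rightarrow> 'n cmat" where
  "Mk H0 HI k \<beta> = ((-1) ^ k) *\<^sub>R
     nested_int k \<beta> (\<lambda>ts. pinch H0 (mprod (map (HIt H0 HI) ts)))"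

(* the explicit expression for g_k; omega is indexed by 1..k-1 *)
definition gexpr :: "nat \<Rightarrow> real \<Rightarrow> (nat \<Rightarrow> real) \<Rightarrow> real" where
  "gexpr k \<beta> \<omega> =
     (let s = (\<lambda>l. \<Sum>j=1..l. \<omega> j) in
      (1 / (\<Prod>l=1..k-1. s l)) * (\<beta> - (\<Sum>l=1..k-1. 1 / s l))
      - (\<Sum>p=1..k-1. (-1) ^ p * exp (- \<beta> * s p) /
           ((\<Prod>m=2..p. \<Sum>i=m..p. \<omega> i) * (s p)\<^sup>2 * (\<Prod>l=p+1..k-1. \<Sum>j=p+1..l. \<omega> j))))"

(* frequency tuples for which no denominator vanishes *)
definition nondeg :: "nat \<Rightarrow> (nat \<Rightarrow> real) set" where
  "nondeg k = {\<omega>. \<forall>m l. 1 \<le> m \<and> m \<le> l \<and> l \<le> k - 1 \<longrightarrow> (\<Sum>j=m..l. \<omega> j) \<noteq> 0}"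

(* g_k: the expression, extended by its limit where denominators vanish *)
definition gk :: "nat \<Rightarrow> real \<Rightarrow> (nat \<Rightarrow> real) \<Rightarrow> real" where
  "gk k \<beta> \<omega> = (if \<omega> \<in> nondeg k then gexpr k \<beta> \<omega>
                 else Lim (at \<omega> within nondeg k) (gexpr k \<beta>))"

end

theory Submission
  imports Defs
begin

(* Expanding H_I(t) = sum_w exp(-t w) D_w over the Bohr frequencies w turns the integrand of M_k
   into a combination of words D_{v_1} ... D_{v_k}, and the pinching keeps exactly the words with
   v_1 + ... + v_k = 0.  The coefficient of such a word is the simplex integral of
   exp(-(v_1 t_1 + ... + v_k t_k)), which is the divided difference of y |-> exp(-beta y) at the
   partial sums 0, v_1, v_1 + v_2, ... (Hermite-Genocchi).  For pairwise distinct partial sums this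
   divided difference evaluates to g_k; as the integral depends continuously on the frequencies,
   it also equals the continuous extension of g_k at the degenerate ones. *)

(* The sign convention differs from the usual divided difference f[x_0, ..., x_n] by (-1)^n. *)
definition divdiff :: "(real \<Rightarrow> real) \<Rightarrow> ('i \<Rightarrow> real) \<Rightarrow> 'i set \<Rightarrow> real" where
  "divdiff g x S = (\<Sum>j\<in>S. g (x j) / (\<Prod>i\<in>S - {j}. (x i - x j)))"

lemma prod_diff_nonzero:
  fixes x :: "'i \<Rightarrow> real"
  assumes "finite A" "inj_on x (insert j A)"
  shows "(\<Prod>i\<in>A - {j}. (x i - x j)) \<noteq> 0"
  using assms by (auto simp: inj_on_def)

lemma divdiff_summand_recurrence:
  fixes x :: "'i \<Rightarrow> real"
  assumes fin: "finite S" and inj: "inj_on x S" and S: "a \<in> S" "b \<in> S" "j \<in> S"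
    and ne: "a \<noteq> b" "j \<noteq> a" "j \<noteq> b"
  shows "c / (\<Prod>i\<in>S - {j}. (x i - x j))
    = (c / (\<Prod>i\<in>S - {b} - {j}. (x i - x j)) - c / (\<Prod>i\<in>S - {a} - {j}. (x i - x j))) / (x b - x a)"
proof -
  define R where "R = S - {a, b, j}"
  define P where "P = (\<Prod>i\<in>R. (x i - x j))"
  have finR: "finite R" and notR: "a \<notin> R" "b \<notin> R" unfolding R_def using fin by auto
  have "inj_on x (insert j R)" by (rule inj_on_subset[OF inj]) (use S in \<open>auto simp: R_def\<close>)
  from prod_diff_nonzero[OF finR this] have P: "P \<noteq> 0"
    unfolding P_def by (simp add: R_def Diff_insert_absorb)
  have nz: "x a - x j \<noteq> 0" "x b - x j \<noteq> 0" "(x b - x j) - (x a - x j) \<noteq> 0"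
    using inj S ne by (auto simp: inj_on_def)
  have "S - {j} = insert a (insert b R)" "S - {b} - {j} = insert a R" "S - {a} - {j} = insert b R"
    using S ne unfolding R_def by auto
  then have prods: "(\<Prod>i\<in>S - {j}. (x i - x j)) = (x a - x j) * ((x b - x j) * P)"
    "(\<Prod>i\<in>S - {b} - {j}. (x i - x j)) = (x a - x j) * P"
    "(\<Prod>i\<in>S - {a} - {j}. (x i - x j)) = (x b - x j) * P"
    using finR notR ne unfolding P_def by simp_all
  have "c / (u * (v * P)) = (c / (u * P) - c / (v * P)) / (v - u)"
    if "u \<noteq> 0" "v \<noteq> 0" "v - u \<noteq> 0" for u v :: real
    using that P by (simp add: field_simps)
  from this[OF nz] show ?thesis unfolding prods by simp
qed

lemma divdiff_recurrence:
  fixes x :: "'i \<Rightarrow> real"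
  assumes fin: "finite S" and inj: "inj_on x S" and S: "a \<in> S" "b \<in> S" and ab: "a \<noteq> b"
  shows "divdiff g x S = (divdiff g x (S - {b}) - divdiff g x (S - {a})) / (x b - x a)"
proof -
  define R where "R = S - {a, b}"
  define F where "F A j = g (x j) / (\<Prod>i\<in>A - {j}. (x i - x j))" for A j
  have finR: "finite R" and notR: "a \<notin> R" "b \<notin> R" unfolding R_def using fin by auto
  have S_eq: "S = insert a (insert b R)" "S - {b} = insert a R" "S - {a} = insert b R"
    unfolding R_def using S ab by auto
  have xab: "x b - x a \<noteq> 0" using inj S ab by (auto simp: inj_on_def)
  have R_terms: "(\<Sum>j\<in>R. F S j) = ((\<Sum>j\<in>R. F (S - {b}) j) - (\<Sum>j\<in>R. F (S - {a}) j)) / (x b - x a)"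
    unfolding sum_subtractf[symmetric] sum_divide_distrib F_def R_def
    using divdiff_summand_recurrence[OF fin inj S] ab by (intro sum.cong refl) auto
  have a_term: "F S a = F (S - {b}) a / (x b - x a)"
    unfolding F_def S_eq using finR notR ab by (simp add: insert_Diff_if divide_divide_eq_left mult.commute)
  have "F S b = g (x b) / ((x a - x b) * (\<Prod>i\<in>R. (x i - x b)))" "F (S - {a}) b = g (x b) / (\<Prod>i\<in>R. (x i - x b))"
    unfolding F_def S_eq using finR notR ab by (simp_all add: insert_Diff_if)
  moreover have "c / ((x a - x b) * P) = - (c / P) / (x b - x a)" for c P :: real
  proof -
    have "(x a - x b) * P = - ((x b - x a) * P)" by (simp add: algebra_simps)
    then show ?thesis by (simp only: divide_minus_right divide_divide_eq_left mult.commute minus_divide_left)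
  qed
  ultimately have b_term: "F S b = - F (S - {a}) b / (x b - x a)"
    by simp
  have "divdiff g x S = F S a + F S b + (\<Sum>j\<in>R. F S j)"
    unfolding divdiff_def F_def S_eq(1) using finR notR ab by (simp add: add.assoc)
  also have "\<dots> = ((F (S - {b}) a + (\<Sum>j\<in>R. F (S - {b}) j)) - (F (S - {a}) b + (\<Sum>j\<in>R. F (S - {a}) j)))
      / (x b - x a)"
    unfolding a_term b_term R_terms by (simp add: diff_divide_distrib add_divide_distrib)
  also have "\<dots> = (divdiff g x (S - {b}) - divdiff g x (S - {a})) / (x b - x a)"
    unfolding divdiff_def F_def[symmetric] S_eq(2,3) using finR notR by simp
  finally show ?thesis .
qed

lemma divdiff_const:
  fixes x :: "'i \<Rightarrow> real"
  assumes "finite S" "inj_on x S" "card S \<ge> 2"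
  shows "divdiff (\<lambda>_. c) x S = 0"
  using assms
proof (induction "card S" arbitrary: S rule: less_induct)
  case less
  obtain a b where ab: "a \<in> S" "b \<in> S" "a \<noteq> b"
    using less.prems card_le_Suc0_iff_eq[of S] by force
  have rec: "divdiff (\<lambda>_. c) x S = (divdiff (\<lambda>_. c) x (S - {b}) - divdiff (\<lambda>_. c) x (S - {a})) / (x b - x a)"
    by (rule divdiff_recurrence[OF less.prems(1,2) ab])
  show ?case
  proof (cases "card S = 2")
    case True
    then have "S = {a, b}" using ab less.prems(1)
      by (metis card_2_iff doubleton_eq_iff insert_iff singletonD)
    with ab show ?thesis using rec by (simp add: divdiff_def insert_Diff_if)
  next
    case False
    have "divdiff (\<lambda>_. c) x (S - {d}) = 0" if "d \<in> S" for d
      using less.prems False that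
      by (intro less.hyps) (auto simp: card_Diff_singleton card_Diff1_less inj_on_subset[OF less.prems(2)])
    with ab show ?thesis using rec by simp
  qed
qed

lemma divdiff_inverse_square:
  fixes x :: "'i \<Rightarrow> real"
  assumes "finite S" "inj_on x S" "\<And>j. j \<in> S \<Longrightarrow> x j \<noteq> 0"
  shows "divdiff (\<lambda>y. 1 / y^2) x S = (\<Sum>j\<in>S. 1 / x j) / (\<Prod>j\<in>S. x j)"
  using assms
proof (induction "card S" arbitrary: S rule: less_induct)
  case less
  show ?case
  proof (cases "card S \<le> 1")
    case True
    show ?thesis
    proof (cases "S = {}")
      case False
      then have "card S = 1" using True less.prems(1) by (simp add: le_Suc_eq)
      then obtain a where "S = {a}" by (rule card_1_singletonE)
      then show ?thesis by (simp add: divdiff_def power2_eq_square)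
    qed (simp add: divdiff_def)
  next
    case False
    obtain a b where ab: "a \<in> S" "b \<in> S" "a \<noteq> b"
      using less.prems(1) False card_le_Suc0_iff_eq[of S] by force
    define P where "P = (\<Prod>j\<in>S. x j)"
    define Q where "Q = (\<Sum>j\<in>S. 1 / x j)"
    have IH: "divdiff (\<lambda>y. 1 / y^2) x (S - {d}) = (Q - 1 / x d) / (P / x d)" if d: "d \<in> S" for d
    proof -
      have "divdiff (\<lambda>y. 1 / y^2) x (S - {d}) = (\<Sum>j\<in>S - {d}. 1 / x j) / (\<Prod>j\<in>S - {d}. x j)"
        using less.prems d
        by (intro less.hyps[OF card_Diff1_less[OF less.prems(1) d]]) (auto simp: inj_on_subset[OF less.prems(2)])
      also have "\<dots> = (Q - 1 / x d) / (P / x d)"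
        unfolding P_def Q_def using less.prems d
        by (simp add: sum_diff1 prod_diff1)
      finally show ?thesis .
    qed
    have "P \<noteq> 0" "x a \<noteq> 0" "x b \<noteq> 0" "x b - x a \<noteq> 0"
      unfolding P_def using less.prems ab by (auto simp: inj_on_def)
    then show ?thesis
      unfolding divdiff_recurrence[OF less.prems(1,2) ab] IH[OF ab(1)] IH[OF ab(2)]
        P_def[symmetric] Q_def[symmetric] by (simp add: field_simps)
  qed
qed

lemma divdiff_cong:
  "(\<And>j. j \<in> S \<Longrightarrow> x j = y j) \<Longrightarrow> (\<And>j. j \<in> S \<Longrightarrow> g (x j) = h (y j)) \<Longrightarrow>
    divdiff g x S = divdiff h y S"
  unfolding divdiff_def by (intro sum.cong refl arg_cong2[where f = "(/)"] prod.cong) auto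

lemma divdiff_insert_split:
  assumes "finite S" "i \<notin> S"
  shows "divdiff g x (insert i S) = g (x i) / (\<Prod>k\<in>S. (x k - x i))
    + (\<Sum>j\<in>S. g (x j) / ((x i - x j) * (\<Prod>k\<in>S - {j}. (x k - x j))))"
proof -
  have "insert i S - {j} = insert i (S - {j})" if "j \<in> S" for j
    using assms that by auto
  then show ?thesis
    unfolding divdiff_def using assms by (simp cong: sum.cong)
qed

lemma divdiff_reindex:
  assumes "inj_on f S"
  shows "divdiff g x (f ` S) = divdiff g (x \<circ> f) S"
proof -
  have "f ` S - {f j} = f ` (S - {j})" if "j \<in> S" for j
    using assms that by (auto simp: inj_on_def)
  then show ?thesis
    unfolding divdiff_def using assms
    by (simp add: sum.reindex prod.reindex inj_on_diff cong: sum.cong)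
qed

lemma divdiff_insert:
  fixes x :: "'i \<Rightarrow> real"
  assumes fin: "finite S" and ne: "S \<noteq> {}" and i: "i \<notin> S" and inj: "inj_on x (insert i S)"
  shows "divdiff g x (insert i S) = divdiff (\<lambda>y. (g (x i) - g y) / (y - x i)) x S"
proof -
  define P where "P j = (\<Prod>k\<in>insert i S - {j}. (x k - x j))" for j
  have Pi: "P i = (\<Prod>k\<in>S. (x k - x i))" unfolding P_def using i by simp
  have Pj: "P j = (x i - x j) * (\<Prod>k\<in>S - {j}. (x k - x j))" if "j \<in> S" for j
  proof -
    have "insert i S - {j} = insert i (S - {j})" using i that by auto
    then show ?thesis unfolding P_def using fin i by simp
  qed
  have "card S \<ge> 1" using fin ne by (simp add: Suc_leI card_gt_0_iff)
  then have "card (insert i S) \<ge> 2" using fin i by simp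
  with fin inj have "divdiff (\<lambda>_. 1) x (insert i S) = 0" by (intro divdiff_const) simp_all
  then have node_i: "1 / P i = - (\<Sum>j\<in>S. 1 / P j)"
    unfolding divdiff_def P_def[symmetric] using fin i by (simp add: eq_neg_iff_add_eq_0)
  have quotient: "(a - c) / (u - v) / Q = c / ((v - u) * Q) - a * (1 / ((v - u) * Q))" for a c u v Q :: real
  proof -
    have "(a - c) / (u - v) / Q = (c - a) / ((v - u) * Q)"
      by (metis divide_divide_eq_left minus_diff_eq minus_divide_divide)
    then show ?thesis by (simp add: diff_divide_distrib)
  qed
  have "(g (x i) - g (x j)) / (x j - x i) / (\<Prod>k\<in>S - {j}. (x k - x j)) = g (x j) / P j - g (x i) * (1 / P j)"
    if "j \<in> S" for j
    unfolding Pj[OF that] by (rule quotient)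
  then have "divdiff (\<lambda>y. (g (x i) - g y) / (y - x i)) x S = (\<Sum>j\<in>S. g (x j) / P j) - g (x i) * (\<Sum>j\<in>S. 1 / P j)"
    unfolding divdiff_def by (simp add: sum_subtractf sum_distrib_left)
  also have "\<dots> = g (x i) * (1 / P i) + (\<Sum>j\<in>S. g (x j) / P j)"
    unfolding node_i by simp
  also have "\<dots> = divdiff g x (insert i S)"
    unfolding divdiff_def P_def[symmetric] using fin i by simp
  finally show ?thesis ..
qed

definition cinner :: "complex^'n::finite \<Rightarrow> complex^'n \<Rightarrow> complex" where
  "cinner x y = (\<Sum>i\<in>UNIV. cnj (x$i) * y$i)"

lemma cinner_cadj: "cinner (A *v x) y = cinner x (cadj A *v y)"
proof -
  have "cinner (A *v x) y = (\<Sum>i\<in>UNIV. \<Sum>j\<in>UNIV. cnj (A$i$j) * cnj (x$j) * y$i)"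
    unfolding cinner_def matrix_vector_mult_def by (simp add: sum_distrib_right)
  also have "\<dots> = (\<Sum>j\<in>UNIV. \<Sum>i\<in>UNIV. cnj (A$i$j) * cnj (x$j) * y$i)"
    by (rule sum.swap)
  also have "\<dots> = cinner x (cadj A *v y)"
    unfolding cinner_def matrix_vector_mult_def cadj_def by (simp add: sum_distrib_left mult_ac)
  finally show ?thesis .
qed

lemma Re_cinner: "Re (cinner x y) = x \<bullet> y"
  unfolding cinner_def inner_vec_def by (simp add: Re_sum inner_complex_def)

lemma cinner_add_left: "cinner (x + y) z = cinner x z + cinner y z"
  unfolding cinner_def by (simp add: sum.distrib algebra_simps)

lemma cinner_add_right: "cinner z (x + y) = cinner z x + cinner z y"
  unfolding cinner_def by (simp add: sum.distrib algebra_simps)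

lemma cinner_diff_right: "cinner z (x - y) = cinner z x - cinner z y"
  unfolding cinner_def by (simp add: sum_subtractf algebra_simps)

lemma cinner_scaleR_left: "cinner (r *\<^sub>R x) y = of_real r * cinner x y"
  unfolding cinner_def
  by (simp only: vector_scaleR_component) (simp add: sum_distrib_left scaleR_conv_of_real mult_ac)

lemma cinner_scaleR_right: "cinner x (r *\<^sub>R y) = of_real r * cinner x y"
  unfolding cinner_def
  by (simp only: vector_scaleR_component) (simp add: sum_distrib_left scaleR_conv_of_real mult_ac)

lemma cinner_zero_left [simp]: "cinner 0 y = 0"
  unfolding cinner_def by simp

lemma cinner_zero_right [simp]: "cinner x 0 = 0"
  unfolding cinner_def by simp

lemma cinner_self_eq_0: "cinner x x = 0 \<Longrightarrow> x = 0"
  by (metis Re_cinner inner_eq_zero_iff zero_complex.sel(1))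

lemma linear_cinner_left: "linear (\<lambda>x. cinner x y)"
proof (rule linearI)
  show "cinner (r *\<^sub>R b) y = r *\<^sub>R cinner b y" for r b
    by (subst cinner_scaleR_left) (simp add: scaleR_conv_of_real)
qed (rule cinner_add_left)

lemma linear_cinner_right: "linear (\<lambda>y. cinner x y)"
proof (rule linearI)
  show "cinner x (r *\<^sub>R b) = r *\<^sub>R cinner x b" for r b
    by (subst cinner_scaleR_right) (simp add: scaleR_conv_of_real)
qed (rule cinner_add_right)

lemma matrix_eq_cinner:
  fixes A B :: "complex^'n::finite^'n"
  assumes "\<And>x y. cinner x (A *v y) = cinner x (B *v y)"
  shows "A = B"
proof -
  have "cinner (A *v y - B *v y) (A *v y - B *v y) = 0" for y
    using assms by (simp add: cinner_diff_right)
  then show ?thesis by (simp add: matrix_eq) (metis cinner_self_eq_0 eq_iff_diff_eq_0)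
qed

lemma cadj_matrix_mult: "cadj (A ** B) = cadj B ** cadj (A :: complex^'n::finite^'n)"
  unfolding cadj_def matrix_matrix_mult_def by (simp add: vec_eq_iff mult.commute)

lemma hermitian_cinner:
  "hermitian H \<Longrightarrow> cinner (H *v x) y = cinner x (H *v y)"
  using cinner_cadj unfolding hermitian_def by metis

lemma hermitian_inner:
  "hermitian H \<Longrightarrow> (H *v x) \<bullet> y = x \<bullet> (H *v y)"
  using hermitian_cinner Re_cinner by metis

lemma scaleR_matrix_vector_assoc: "(c *\<^sub>R A) *v x = c *\<^sub>R (A *v (x::complex^'n::finite))"
  by (simp add: vec_eq_iff matrix_vector_mult_def scaleR_sum_right)

lemma matrix_vector_mult_scaleR_complex: "A *v (c *\<^sub>R x) = c *\<^sub>R (A *v (x::complex^'n::finite))"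
  using matrix_vector_mul_linear[of A] by (simp add: linear_iff)

lemma scaleR_eq_smult_of_real: "(c::real) *\<^sub>R (x::complex^'n::finite) = complex_of_real c *s x"
  by (simp only: vec_eq_iff vector_scaleR_component vector_smult_component) (simp add: scaleR_conv_of_real)

lemma eigvals_iff: "e \<in> eigvals H \<longleftrightarrow> (\<exists>v. v \<noteq> 0 \<and> H *v v = e *\<^sub>R v)"
  unfolding eigvals_def by (simp add: scaleR_eq_smult_of_real)

lemma eigspace_iff: "v \<in> eigspace H e \<longleftrightarrow> H *v v = e *\<^sub>R v"
  unfolding eigspace_def by (simp add: scaleR_eq_smult_of_real)

lemma linear_coeff_eq_0_if_quadratic_nonpos:
  fixes a b :: real
  assumes "\<And>t. a * t + b * t^2 \<le> 0"
  shows "a = 0"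
proof (rule ccontr)
  assume "a \<noteq> 0"
  define s where "s = \<bar>b\<bar> + 1"
  have s: "s > 0" "\<bar>b\<bar> = s - 1" unfolding s_def by simp_all
  have "- \<bar>b\<bar> * (a / s)^2 \<le> b * (a / s)^2"
    by (intro mult_right_mono) auto
  then have "a * (a / s) + b * (a / s)^2 \<ge> a * (a / s) - \<bar>b\<bar> * (a / s)^2"
    by simp
  also have "a * (a / s) - \<bar>b\<bar> * (a / s)^2 = a^2 / s^2"
    using s unfolding s(2) by (simp add: field_simps power2_eq_square)
  finally show False using assms[of "a / s"] \<open>a \<noteq> 0\<close> s by (smt (verit) divide_pos_pos zero_less_power2)
qed

lemma hermitian_max_quadratic_form_stationary:
  fixes H :: "complex^'n::finite^'n"
  assumes herm: "hermitian H" and W: "subspace W" and v: "v \<in> W" "v \<bullet> v = 1"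
    and max: "\<And>u. u \<in> W \<Longrightarrow> u \<bullet> (H *v u) \<le> (v \<bullet> (H *v v)) * (u \<bullet> u)"
    and w: "w \<in> W"
  shows "w \<bullet> (H *v v) = (v \<bullet> (H *v v)) * (v \<bullet> w)"
proof -
  define l where "l = v \<bullet> (H *v v)"
  have sym: "v \<bullet> (H *v w) = w \<bullet> (H *v v)"
    using hermitian_inner[OF herm, of v w] by (simp add: inner_commute)
  have "(2 * (w \<bullet> (H *v v) - l * (v \<bullet> w))) * t + (w \<bullet> (H *v w) - l * (w \<bullet> w)) * t^2 \<le> 0" for t
  proof -
    have "(v + t *\<^sub>R w) \<bullet> (H *v (v + t *\<^sub>R w)) \<le> l * ((v + t *\<^sub>R w) \<bullet> (v + t *\<^sub>R w))"
      unfolding l_def using v w W by (intro max) (simp add: subspace_add subspace_scale)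
    then show ?thesis
      using v(2) unfolding l_def
      by (simp add: matrix_vector_right_distrib matrix_vector_mult_scaleR_complex inner_add_left
          inner_add_right inner_commute sym power2_eq_square algebra_simps)
  qed
  from linear_coeff_eq_0_if_quadratic_nonpos[OF this] show ?thesis unfolding l_def by simp
qed

lemma hermitian_invariant_subspace_has_eigenvector:
  fixes H :: "complex^'n::finite^'n"
  assumes herm: "hermitian H" and W: "subspace W" and inv: "\<And>w. w \<in> W \<Longrightarrow> H *v w \<in> W"
    and w0: "w0 \<in> W" "w0 \<noteq> 0"
  shows "\<exists>v\<in>W. v \<noteq> 0 \<and> (\<exists>l::real. H *v v = l *\<^sub>R v)"
proof -
  define K where "K = sphere 0 1 \<inter> W"
  have "compact K" unfolding K_def by (simp add: W closed_subspace compact_Int_closed)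
  moreover have "w0 /\<^sub>R norm w0 \<in> K" unfolding K_def using w0 by (simp add: subspace_scale[OF W])
  moreover have "continuous_on K (\<lambda>v. v \<bullet> (H *v v))"
    by (intro continuous_intros linear_continuous_on matrix_vector_mul_linear linear_linear)
  ultimately obtain v where vK: "v \<in> K" and vmax: "\<And>y. y \<in> K \<Longrightarrow> y \<bullet> (H *v y) \<le> v \<bullet> (H *v v)"
    using continuous_attains_sup[of K] by blast
  define l where "l = v \<bullet> (H *v v)"
  have vW: "v \<in> W" and vv: "v \<bullet> v = 1" using vK unfolding K_def by (auto simp: norm_eq_1)
  have max: "u \<bullet> (H *v u) \<le> l * (u \<bullet> u)" if u: "u \<in> W" for u
  proof (cases "u = 0")
    case False
    then have "u /\<^sub>R norm u \<in> K" unfolding K_def using u by (simp add: subspace_scale[OF W])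
    then have "(u \<bullet> (H *v u)) / (norm u)^2 \<le> l"
      using vmax unfolding l_def
      by (force simp: matrix_vector_mult_scaleR_complex power2_eq_square divide_inverse mult_ac)
    then show ?thesis using False by (simp add: divide_le_eq power2_norm_eq_inner)
  qed simp
  define z where "z = H *v v - l *\<^sub>R v"
  have "z \<in> W" unfolding z_def using inv[OF vW] vW W by (simp add: subspace_diff subspace_scale)
  have "z \<bullet> z = z \<bullet> (H *v v) - l * (z \<bullet> v)"
    unfolding z_def by (simp add: inner_diff_right)
  also have "\<dots> = 0"
    using hermitian_max_quadratic_form_stationary[OF herm W vW vv max[unfolded l_def] \<open>z \<in> W\<close>]
    unfolding l_def by (simp add: inner_commute)
  finally have "H *v v = l *\<^sub>R v" unfolding z_def by simp
  then show ?thesis using vW vv by (intro bexI[of _ v]) auto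
qed

definition eigenvectors :: "complex^'n::finite^'n \<Rightarrow> (complex^'n) set" where
  "eigenvectors H = {v. \<exists>e::real. H *v v = e *\<^sub>R v}"

lemma in_span_eigenvectors:
  fixes H :: "complex^'n::finite^'n"
  assumes herm: "hermitian H"
  shows "x \<in> span (eigenvectors H)"
proof -
  define W where "W = {y. \<forall>x \<in> eigenvectors H. orthogonal x y}"
  have W: "subspace W" unfolding W_def by (rule subspace_orthogonal_to_vectors)
  have inv: "H *v y \<in> W" if "y \<in> W" for y
    unfolding W_def orthogonal_def
  proof (intro CollectI ballI)
    fix x assume "x \<in> eigenvectors H"
    then obtain e where e: "H *v x = e *\<^sub>R x" unfolding eigenvectors_def by auto
    have "x \<bullet> (H *v y) = e * (x \<bullet> y)" using hermitian_inner[OF herm, of x y] e by simp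
    also have "\<dots> = 0" using that \<open>x \<in> eigenvectors H\<close> unfolding W_def orthogonal_def by auto
    finally show "x \<bullet> (H *v y) = 0" .
  qed
  have W0: "y = 0" if "y \<in> W" for y
  proof (rule ccontr)
    assume "y \<noteq> 0"
    from hermitian_invariant_subspace_has_eigenvector[OF herm W inv that this]
    obtain v where "v \<in> W" "v \<noteq> 0" "v \<in> eigenvectors H" unfolding eigenvectors_def by blast
    then show False unfolding W_def by (auto simp: orthogonal_def)
  qed
  obtain y z where y: "y \<in> span (eigenvectors H)" and x: "x = y + z"
    and z: "\<And>w. w \<in> span (eigenvectors H) \<Longrightarrow> orthogonal z w"
    by (rule orthogonal_subspace_decomp_exists[of "eigenvectors H" x]) blast
  have "z \<in> W" unfolding W_def using z span_base by (auto simp: orthogonal_commute)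
  then have "z = 0" by (rule W0)
  then show ?thesis using x y by simp
qed

lemma hermitian_eigenvectors_orthogonal:
  assumes herm: "hermitian H" and x: "H *v x = e *\<^sub>R x" and y: "H *v y = f *\<^sub>R y" and "e \<noteq> f"
  shows "cinner x y = 0"
proof -
  have "of_real e * cinner x y = of_real f * cinner x y"
    using hermitian_cinner[OF herm, of x y] x y by (simp add: cinner_scaleR_left cinner_scaleR_right)
  then show ?thesis using \<open>e \<noteq> f\<close> by simp
qed

lemma finite_eigvals:
  assumes herm: "hermitian H"
  shows "finite (eigvals H)"
proof -
  obtain vf where vf: "\<And>e. e \<in> eigvals H \<Longrightarrow> vf e \<noteq> 0 \<and> H *v vf e = e *\<^sub>R vf e"
    using eigvals_iff by metis
  have orth: "cinner (vf e) (vf f) = 0" if "e \<in> eigvals H" "f \<in> eigvals H" "e \<noteq> f" for e f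
    using hermitian_eigenvectors_orthogonal[OF herm] vf that by metis
  have "inj_on vf (eigvals H)"
    by (rule inj_onI) (metis orth cinner_self_eq_0 vf)
  moreover have "pairwise orthogonal (vf ` eigvals H)"
    unfolding pairwise_def orthogonal_def using orth Re_cinner by (metis imageE zero_complex.sel(1))
  then have "independent (vf ` eigvals H)"
    using vf by (intro pairwise_orthogonal_independent) auto
  ultimately show ?thesis using finiteI_independent finite_imageD by blast
qed

text \<open>Lagrange interpolation polynomial in H: the identity on the eigenspace of e and zero on all
  other eigenspaces.\<close>

definition eigenprojector :: "complex^'n::finite^'n \<Rightarrow> real \<Rightarrow> complex^'n^'n" where
  "eigenprojector H e = foldr (\<lambda>f M. ((1 / (e - f)) *\<^sub>R (H - f *\<^sub>R mat 1)) ** M)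
     (sorted_list_of_set (eigvals H - {e})) (mat 1)"

lemma lagrange_factors_mult_eigenvector:
  fixes H :: "complex^'n::finite^'n"
  assumes "H *v x = g *\<^sub>R x"
  shows "foldr (\<lambda>f M. ((1 / (e - f)) *\<^sub>R (H - f *\<^sub>R mat 1)) ** M) fs (mat 1) *v x
    = (\<Prod>f\<leftarrow>fs. (g - f) / (e - f)) *\<^sub>R x"
proof (induction fs)
  case (Cons f fs)
  then show ?case
    using assms
    by (simp add: matrix_vector_mul_assoc[symmetric] scaleR_matrix_vector_assoc
        matrix_vector_mult_diff_rdistrib matrix_vector_mult_scaleR_complex algebra_simps divide_inverse)
qed simp

lemma eigenprojector_mult_eigenvector:
  assumes herm: "hermitian H" and x: "H *v x = g *\<^sub>R x"
  shows "eigenprojector H e *v x = (if g = e then x else 0)"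
proof (cases "x = 0")
  case False
  then have g: "g \<in> eigvals H" using x eigvals_iff by blast
  have fin: "finite (eigvals H - {e})" using finite_eigvals[OF herm] by simp
  have "eigenprojector H e *v x = (\<Prod>f\<in>eigvals H - {e}. (g - f) / (e - f)) *\<^sub>R x"
    unfolding eigenprojector_def lagrange_factors_mult_eigenvector[OF x]
    using prod.distinct_set_conv_list[of "sorted_list_of_set (eigvals H - {e})" "\<lambda>f. (g - f) / (e - f)"] fin
    by simp
  also have "(\<Prod>f\<in>eigvals H - {e}. (g - f) / (e - f)) = (if g = e then 1 else 0)"
    using g fin by (auto intro: prod.neutral prod_zero)
  finally show ?thesis by simp
qed simp

lemma matrix_eq_on_eigenvectors:
  fixes A B :: "complex^'n::finite^'n"
  assumes herm: "hermitian H" and eq: "\<And>x g. H *v x = g *\<^sub>R x \<Longrightarrow> A *v x = B *v x"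
  shows "A = B"
proof -
  have "A *v x = B *v x" for x
    by (rule linear_eq_on_span[OF matrix_vector_mul_linear matrix_vector_mul_linear _ in_span_eigenvectors[OF herm]])
       (auto simp: eigenvectors_def intro: eq)
  then show ?thesis by (simp add: matrix_eq)
qed

lemma sum_matrix_vector_mult: "(\<Sum>i\<in>S. A i) *v x = (\<Sum>i\<in>S. A i *v (x::complex^'n::finite))"
  by (induction S rule: infinite_finite_induct) (simp_all add: matrix_vector_mult_add_rdistrib)

lemma eigenprojector_mult:
  assumes herm: "hermitian H"
  shows "eigenprojector H e ** eigenprojector H f = (if e = f then eigenprojector H e else 0)"
proof (rule matrix_eq_on_eigenvectors[OF herm])
  fix x g assume "H *v x = g *\<^sub>R x"
  from eigenprojector_mult_eigenvector[OF herm this]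
  show "(eigenprojector H e ** eigenprojector H f) *v x = (if e = f then eigenprojector H e else 0) *v x"
    by (simp add: matrix_vector_mul_assoc[symmetric])
qed

lemma sum_eigenprojector: "hermitian H \<Longrightarrow> (\<Sum>e\<in>eigvals H. eigenprojector H e) = mat 1"
proof (rule matrix_eq_on_eigenvectors)
  fix x g assume herm: "hermitian H" and x: "H *v x = g *\<^sub>R x"
  show "(\<Sum>e\<in>eigvals H. eigenprojector H e) *v x = mat 1 *v x"
  proof (cases "x = 0")
    case False
    then have "g \<in> eigvals H" using x eigvals_iff by blast
    then show ?thesis
      unfolding sum_matrix_vector_mult using eigenprojector_mult_eigenvector[OF herm x] finite_eigvals[OF herm]
      by simp
  qed simp
qed

lemma hermitian_mult_eigenprojector:
  assumes herm: "hermitian H"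
  shows "H ** eigenprojector H e = e *\<^sub>R eigenprojector H e"
proof (rule matrix_eq_on_eigenvectors[OF herm])
  fix x g assume x: "H *v x = g *\<^sub>R x"
  from eigenprojector_mult_eigenvector[OF herm this] x
  show "(H ** eigenprojector H e) *v x = (e *\<^sub>R eigenprojector H e) *v x"
    by (simp add: matrix_vector_mul_assoc[symmetric] scaleR_matrix_vector_assoc)
qed

lemma cadj_eigenprojector:
  assumes herm: "hermitian H"
  shows "cadj (eigenprojector H e) = eigenprojector H e"
proof -
  let ?L = "eigenprojector H e"
  have on_eigenvectors: "cinner (?L *v x) y = cinner x (?L *v y)"
    if x: "H *v x = g *\<^sub>R x" and y: "H *v y = h *\<^sub>R y" for x y g h
    using hermitian_eigenvectors_orthogonal[OF herm x y]
      eigenprojector_mult_eigenvector[OF herm x] eigenprojector_mult_eigenvector[OF herm y]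
    by (cases "g = h") auto
  have on_left_eigenvectors: "cinner (?L *v x) y = cinner x (?L *v y)" if x: "H *v x = g *\<^sub>R x" for x g y
    by (rule linear_eq_on_span[OF linear_cinner_right
          linear_compose[OF matrix_vector_mul_linear linear_cinner_right, unfolded o_def] _ in_span_eigenvectors[OF herm]])
       (auto simp: eigenvectors_def intro: on_eigenvectors[OF x])
  have "cinner (?L *v x) y = cinner x (?L *v y)" for x y
    by (rule linear_eq_on_span[OF linear_compose[OF matrix_vector_mul_linear linear_cinner_left, unfolded o_def]
          linear_cinner_left _ in_span_eigenvectors[OF herm]])
       (auto simp: eigenvectors_def intro: on_left_eigenvectors)
  then show ?thesis by (intro matrix_eq_cinner) (simp add: cinner_cadj[symmetric])
qed

lemma range_eigenprojector:
  assumes herm: "hermitian H"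
  shows "range ((*v) (eigenprojector H e)) = eigspace H e"
proof
  show "range ((*v) (eigenprojector H e)) \<subseteq> eigspace H e"
    using hermitian_mult_eigenprojector[OF herm]
    by (auto simp: eigspace_iff matrix_vector_mul_assoc scaleR_matrix_vector_assoc)
  show "eigspace H e \<subseteq> range ((*v) (eigenprojector H e))"
    using eigenprojector_mult_eigenvector[OF herm] by (metis eigspace_iff rangeI subsetI)
qed

lemma orthogonal_projector_eq_if_range_eq:
  fixes P Q :: "complex^'n::finite^'n"
  assumes P: "P ** P = P" "cadj P = P" and Q: "Q ** Q = Q" "cadj Q = Q"
    and range: "range ((*v) P) = range ((*v) Q)"
  shows "P = Q"
proof -
  have absorb: "A ** B = B"
    if idem: "A ** A = A" and sub: "range ((*v) B) \<subseteq> range ((*v) A)" for A B :: "complex^'n^'n"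
  proof -
    have "(A ** B) *v y = B *v y" for y
    proof -
      obtain z where "B *v y = A *v z" using sub by auto
      then show ?thesis by (metis matrix_vector_mul_assoc idem)
    qed
    then show ?thesis by (simp add: matrix_eq)
  qed
  have "P = cadj (Q ** P)" using absorb[OF Q(1)] range P(2) by simp
  also have "\<dots> = P ** Q" by (simp add: cadj_matrix_mult P(2) Q(2))
  also have "\<dots> = Q" using absorb[OF P(1)] range by simp
  finally show ?thesis .
qed

lemma specproj_eq_eigenprojector:
  assumes herm: "hermitian H"
  shows "specproj H e = eigenprojector H e"
  unfolding specproj_def
proof (rule the_equality)
  show "eigenprojector H e ** eigenprojector H e = eigenprojector H e \<and>
      cadj (eigenprojector H e) = eigenprojector H e \<and> range ((*v) (eigenprojector H e)) = eigspace H e"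
    using eigenprojector_mult[OF herm] cadj_eigenprojector[OF herm] range_eigenprojector[OF herm] by simp
  then show "P ** P = P \<and> cadj P = P \<and> range ((*v) P) = eigspace H e \<Longrightarrow> P = eigenprojector H e" for P
    using orthogonal_projector_eq_if_range_eq[of P "eigenprojector H e"] by simp
qed

lemma specproj_mult:
  "hermitian H \<Longrightarrow> specproj H e ** specproj H f = (if e = f then specproj H e else 0)"
  by (simp add: specproj_eq_eigenprojector eigenprojector_mult)

lemma sum_specproj: "hermitian H \<Longrightarrow> (\<Sum>e\<in>eigvals H. specproj H e) = mat 1"
  by (simp add: specproj_eq_eigenprojector sum_eigenprojector)

lemma hermitian_mult_specproj: "hermitian H \<Longrightarrow> H ** specproj H e = e *\<^sub>R specproj H e"
  by (simp add: specproj_eq_eigenprojector hermitian_mult_eigenprojector)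

lemmas matrix_mult_scaleR = scalar_matrix_assoc[symmetric] matrix_scalar_ac

lemma matrix_add_rdistrib: "(A + C) ** B = A ** B + C ** (B :: complex^'n::finite^'n)"
  by (simp add: vec_eq_iff matrix_matrix_mult_def sum.distrib distrib_right)

lemma sum_matrix_mult: "(\<Sum>i\<in>S. A i) ** (B :: complex^'n::finite^'n) = (\<Sum>i\<in>S. A i ** B)"
  by (induction S rule: infinite_finite_induct) (simp_all add: matrix_add_rdistrib)

lemma matrix_mult_sum: "(B :: complex^'n::finite^'n) ** (\<Sum>i\<in>S. A i) = (\<Sum>i\<in>S. B ** A i)"
  by (induction S rule: infinite_finite_induct) (simp_all add: matrix_add_ldistrib)

lemma mpow_scaleR_hermitian:
  assumes herm: "hermitian H"
  shows "mpow (s *\<^sub>R H) n = (\<Sum>e\<in>eigvals H. (s * e)^n *\<^sub>R specproj H e)"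
proof (induction n)
  case 0
  then show ?case by (simp add: mpow_def sum_specproj[OF herm])
next
  case (Suc n)
  then show ?case
    by (simp add: mpow_def matrix_mult_sum matrix_mult_scaleR hermitian_mult_specproj[OF herm] mult_ac)
qed

lemma mexp_scaleR_hermitian:
  assumes herm: "hermitian H"
  shows "mexp (s *\<^sub>R H) = (\<Sum>e\<in>eigvals H. exp (s * e) *\<^sub>R specproj H e)"
proof -
  have "mexp (s *\<^sub>R H) = (\<Sum>n. \<Sum>e\<in>eigvals H. ((s * e)^n /\<^sub>R fact n) *\<^sub>R specproj H e)"
    unfolding mexp_def mpow_scaleR_hermitian[OF herm] by (simp add: scaleR_sum_right divide_inverse mult_ac)
  also have "\<dots> = (\<Sum>e\<in>eigvals H. \<Sum>n. ((s * e)^n /\<^sub>R fact n) *\<^sub>R specproj H e)"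
    by (rule suminf_sum) (intro summable_scaleR_left summable_exp_generic)
  also have "\<dots> = (\<Sum>e\<in>eigvals H. (\<Sum>n. inverse (fact n) * (s * e)^n) *\<^sub>R specproj H e)"
    by (simp add: suminf_scaleR_left[OF summable_exp])
  also have "\<dots> = (\<Sum>e\<in>eigvals H. exp (s * e) *\<^sub>R specproj H e)"
    by (simp add: exp_def field_simps)
  finally show ?thesis .
qed

lemma finite_bohr: "hermitian H \<Longrightarrow> finite (bohr H)"
proof -
  assume "hermitian H"
  moreover have "bohr H = (\<lambda>p. snd p - fst p) ` (eigvals H \<times> eigvals H)"
    unfolding bohr_def by force
  ultimately show ?thesis using finite_eigvals[of H] by simp
qed

lemma Dop_eq_sum_pairs: "Dop H0 HI \<nu> = (\<Sum>p\<in>{p \<in> eigvals H0 \<times> eigvals H0. snd p - fst p = \<nu>}.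
     specproj H0 (fst p) ** HI ** specproj H0 (snd p))"
  unfolding Dop_def by (rule sum.cong) (auto simp: case_prod_beta)

lemma Dop_notin_bohr: "\<nu> \<notin> bohr H0 \<Longrightarrow> Dop H0 HI \<nu> = 0"
  unfolding Dop_def bohr_def by (rule sum.neutral) auto

lemma HIt_eq_sum_bohr:
  fixes H0 HI :: "complex^'n::finite^'n"
  assumes herm: "hermitian H0"
  shows "HIt H0 HI t = (\<Sum>\<nu>\<in>bohr H0. exp (- (t * \<nu>)) *\<^sub>R Dop H0 HI \<nu>)"
proof -
  let ?P = "specproj H0" and ?E = "eigvals H0"
  have "HIt H0 HI t = (\<Sum>f\<in>?E. \<Sum>e\<in>?E. (exp (- (t * f)) * exp (t * e)) *\<^sub>R (?P e ** HI ** ?P f))"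
    unfolding HIt_def mexp_scaleR_hermitian[OF herm]
    by (simp add: sum_matrix_mult matrix_mult_sum matrix_mult_scaleR matrix_mul_assoc scaleR_sum_right)
  also have "\<dots> = (\<Sum>p\<in>?E \<times> ?E. exp (- (t * (snd p - fst p))) *\<^sub>R (?P (fst p) ** HI ** ?P (snd p)))"
    by (subst sum.swap) (simp add: sum.cartesian_product case_prod_beta exp_add[symmetric] algebra_simps)
  also have "\<dots> = (\<Sum>\<nu>\<in>bohr H0. \<Sum>p\<in>{p \<in> ?E \<times> ?E. snd p - fst p = \<nu>}.
       exp (- (t * (snd p - fst p))) *\<^sub>R (?P (fst p) ** HI ** ?P (snd p)))"
    using finite_eigvals[OF herm] finite_bohr[OF herm]
    by (intro sum.group[symmetric]) (force simp: bohr_def)+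
  also have "\<dots> = (\<Sum>\<nu>\<in>bohr H0. exp (- (t * \<nu>)) *\<^sub>R Dop H0 HI \<nu>)"
    unfolding Dop_eq_sum_pairs scaleR_sum_right by (intro sum.cong refl) auto
  finally show ?thesis .
qed

lemma mprod_Nil [simp]: "mprod [] = mat 1"
  unfolding mprod_def by simp

lemma mprod_Cons [simp]: "mprod (x # xs) = x ** mprod xs"
  unfolding mprod_def by simp

lemma mprod_append: "mprod (xs @ ys) = mprod xs ** mprod ys"
  by (induction xs) (simp_all add: matrix_mul_assoc)

definition freq_words :: "real set \<Rightarrow> nat \<Rightarrow> real list set" where
  "freq_words B n = {ns. set ns \<subseteq> B \<and> length ns = n}"

definition balanced_words :: "real set \<Rightarrow> nat \<Rightarrow> real list set" where
  "balanced_words B n = {ns \<in> freq_words B n. sum_list ns = 0}"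

lemma finite_freq_words: "finite B \<Longrightarrow> finite (freq_words B n)"
  unfolding freq_words_def by (rule finite_lists_length_eq)

lemma freq_words_Suc: "freq_words B (Suc n) = (\<lambda>(ns, \<nu>). \<nu> # ns) ` (freq_words B n \<times> B)"
  unfolding freq_words_def by (auto simp: lists_length_Suc_eq)

lemma mprod_HIt_eq_sum_words:
  fixes H0 HI :: "complex^'n::finite^'n"
  assumes herm: "hermitian H0"
  shows "mprod (map (HIt H0 HI) ts) = (\<Sum>ns\<in>freq_words (bohr H0) (length ts).
           exp (- (\<Sum>i<length ts. ns!i * ts!i)) *\<^sub>R mprod (map (Dop H0 HI) ns))"
proof (induction ts)
  case Nil
  have "freq_words (bohr H0) 0 = {[]}" unfolding freq_words_def by auto
  then show ?case by simp
next
  case (Cons t ts)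
  let ?B = "bohr H0" and ?n = "length ts" and ?M = "\<lambda>ns. mprod (map (Dop H0 HI) ns)"
  let ?c = "\<lambda>ns. exp (- (\<Sum>i<?n. ns!i * ts!i))"
  have "mprod (map (HIt H0 HI) (t # ts)) = (\<Sum>(ns, \<nu>)\<in>freq_words ?B ?n \<times> ?B.
          (exp (- (t * \<nu>)) * ?c ns) *\<^sub>R (Dop H0 HI \<nu> ** ?M ns))"
    by (simp add: Cons HIt_eq_sum_bohr[OF herm] sum_matrix_mult matrix_mult_sum matrix_mult_scaleR
        scaleR_sum_right sum.cartesian_product mult.commute)
  also have "\<dots> = (\<Sum>ns\<in>freq_words ?B (Suc ?n). exp (- (\<Sum>i<Suc ?n. ns!i * (t#ts)!i)) *\<^sub>R ?M ns)"
    unfolding freq_words_Suc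
    by (subst sum.reindex) (auto simp: inj_on_def freq_words_def sum.lessThan_Suc_shift exp_add[symmetric]
        simp del: sum.lessThan_Suc intro!: sum.cong)
  finally show ?case by simp
qed

lemma specproj_Dop_specproj:
  fixes H0 HI :: "complex^'n::finite^'n"
  assumes herm: "hermitian H0" and a: "a \<in> eigvals H0" and c: "c \<in> eigvals H0"
  shows "specproj H0 a ** Dop H0 HI \<nu> ** specproj H0 c =
         (if c - a = \<nu> then specproj H0 a ** HI ** specproj H0 c else 0)"
proof -
  let ?P = "specproj H0" and ?S = "{p \<in> eigvals H0 \<times> eigvals H0. snd p - fst p = \<nu>}"
  have "?P a ** Dop H0 HI \<nu> ** ?P c = (\<Sum>p\<in>?S. (?P a ** ?P (fst p)) ** HI ** (?P (snd p) ** ?P c))"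
    unfolding Dop_eq_sum_pairs by (simp add: sum_matrix_mult matrix_mult_sum matrix_mul_assoc)
  also have "\<dots> = (\<Sum>p\<in>?S. if (a, c) = p then ?P a ** HI ** ?P c else 0)"
    by (intro sum.cong refl) (auto simp: specproj_mult[OF herm])
  also have "\<dots> = (if (a, c) \<in> ?S then ?P a ** HI ** ?P c else 0)"
    using finite_eigvals[OF herm] by (intro sum.delta') simp
  finally show ?thesis using a c by auto
qed

lemma specproj_mprod_Dop_specproj:
  fixes H0 HI :: "complex^'n::finite^'n"
  assumes herm: "hermitian H0"
  shows "a \<in> eigvals H0 \<Longrightarrow> b \<in> eigvals H0 \<Longrightarrow> b - a \<noteq> sum_list ns \<Longrightarrow>
     specproj H0 a ** mprod (map (Dop H0 HI) ns) ** specproj H0 b = 0"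
proof (induction ns arbitrary: a)
  case Nil
  then show ?case by (simp add: specproj_mult[OF herm])
next
  case (Cons \<nu> ns)
  let ?P = "specproj H0" and ?E = "eigvals H0" and ?D = "Dop H0 HI" and ?M = "mprod (map (Dop H0 HI) ns)"
  have "?P a ** mprod (map ?D (\<nu> # ns)) ** ?P b = ?P a ** ?D \<nu> ** (\<Sum>c\<in>?E. ?P c ** ?P c) ** ?M ** ?P b"
    by (simp add: specproj_mult[OF herm] sum_specproj[OF herm] matrix_mul_assoc)
  also have "\<dots> = (\<Sum>c\<in>?E. (?P a ** ?D \<nu> ** ?P c) ** (?P c ** ?M ** ?P b))"
    by (simp add: sum_matrix_mult matrix_mult_sum matrix_mul_assoc)
  also have "\<dots> = 0"
  proof (rule sum.neutral, intro ballI)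
    fix c assume c: "c \<in> ?E"
    show "(?P a ** ?D \<nu> ** ?P c) ** (?P c ** ?M ** ?P b) = 0"
    proof (cases "c - a = \<nu>")
      case True
      then show ?thesis using Cons.IH[OF c Cons.prems(2)] Cons.prems(3) by simp
    next
      case False
      then show ?thesis using specproj_Dop_specproj[OF herm Cons.prems(1) c] by simp
    qed
  qed
  finally show ?case .
qed

lemma pinch_mprod_Dop:
  fixes H0 HI :: "complex^'n::finite^'n"
  assumes herm: "hermitian H0"
  shows "pinch H0 (mprod (map (Dop H0 HI) ns)) = (if sum_list ns = 0 then mprod (map (Dop H0 HI) ns) else 0)"
proof -
  let ?P = "specproj H0" and ?E = "eigvals H0" and ?X = "mprod (map (Dop H0 HI) ns)"
  have off_diagonal: "?P a ** ?X ** ?P b = 0" if "a \<in> ?E" "b \<in> ?E" "b - a \<noteq> sum_list ns" for a b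
    using specproj_mprod_Dop_specproj[OF herm that] .
  show ?thesis
  proof (cases "sum_list ns = 0")
    case False
    then have "?P a ** ?X ** ?P a = 0" if "a \<in> ?E" for a
      using off_diagonal[OF that that] by simp
    then show ?thesis using False unfolding pinch_def by simp
  next
    case True
    have "?X = mat 1 ** ?X ** mat 1" by simp
    also have "\<dots> = (\<Sum>a\<in>?E. \<Sum>b\<in>?E. ?P a ** ?X ** ?P b)"
      unfolding sum_specproj[OF herm, symmetric] by (simp add: sum_matrix_mult matrix_mult_sum) (rule sum.swap)
    also have "\<dots> = (\<Sum>a\<in>?E. \<Sum>b\<in>?E. if a = b then ?P a ** ?X ** ?P a else 0)"
    proof (intro sum.cong refl)
      fix a b assume "a \<in> ?E" "b \<in> ?E"
      then show "?P a ** ?X ** ?P b = (if a = b then ?P a ** ?X ** ?P a else 0)"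
        using off_diagonal[of a b] True by auto
    qed
    also have "\<dots> = pinch H0 ?X"
      unfolding pinch_def using finite_eigvals[OF herm] by simp
    finally show ?thesis using True by simp
  qed
qed

lemma pinch_sum_scaleR: "pinch H (\<Sum>x\<in>S. c x *\<^sub>R M x) = (\<Sum>x\<in>S. c x *\<^sub>R pinch H (M x))"
  unfolding pinch_def
  by (simp add: sum_matrix_mult matrix_mult_sum matrix_mult_scaleR scaleR_sum_right sum.swap[of _ S])

lemma pinch_mprod_HIt:
  fixes H0 HI :: "complex^'n::finite^'n"
  assumes herm: "hermitian H0"
  shows "pinch H0 (mprod (map (HIt H0 HI) ts)) = (\<Sum>ns\<in>balanced_words (bohr H0) (length ts).
           exp (- (\<Sum>i<length ts. ns!i * ts!i)) *\<^sub>R mprod (map (Dop H0 HI) ns))"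
  unfolding mprod_HIt_eq_sum_words[OF herm] pinch_sum_scaleR pinch_mprod_Dop[OF herm] balanced_words_def
  using finite_freq_words[OF finite_bohr[OF herm]]
  by (simp add: sum.inter_filter if_distrib[of "\<lambda>x. _ *\<^sub>R x"] cong: if_cong)

definition exp_weight :: "(nat \<Rightarrow> real) \<Rightarrow> real list \<Rightarrow> real" where
  "exp_weight a ts = exp (- (\<Sum>i<length ts. a i * ts!i))"

definition simplex_exp_int :: "nat \<Rightarrow> real \<Rightarrow> (nat \<Rightarrow> real) \<Rightarrow> real" where
  "simplex_exp_int m b a = nested_int m b (exp_weight a)"

lemma nested_int_cong:
  "(\<And>ts. length ts = m \<Longrightarrow> f ts = g ts) \<Longrightarrow> nested_int m b f = nested_int m b g"
proof (induction m arbitrary: b f g)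
  case (Suc m)
  have "nested_int m t (\<lambda>ts. f (t # ts)) = nested_int m t (\<lambda>ts. g (t # ts))" for t
    by (rule Suc.IH) (simp add: Suc.prems)
  then show ?case by simp
qed simp

lemma nested_int_scaleR: "nested_int m b (\<lambda>ts. c *\<^sub>R f ts) = c *\<^sub>R nested_int m b f"
  by (induction m arbitrary: b f) simp_all

lemma exp_weight_Cons: "exp_weight a (t # ts) = exp (- (a 0 * t)) * exp_weight (\<lambda>i. a (Suc i)) ts"
  unfolding exp_weight_def
  by (simp del: sum.lessThan_Suc add: sum.lessThan_Suc_shift exp_add[symmetric] algebra_simps)

lemma simplex_exp_int_0 [simp]: "simplex_exp_int 0 b a = 1"
  unfolding simplex_exp_int_def exp_weight_def by simp

lemma simplex_exp_int_Suc:
  "simplex_exp_int (Suc m) b a = integral {0..b} (\<lambda>t. exp (- (a 0 * t)) * simplex_exp_int m t (\<lambda>i. a (Suc i)))"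
proof -
  have "nested_int m t (\<lambda>ts. exp_weight a (t # ts)) = exp (- (a 0 * t)) * simplex_exp_int m t (\<lambda>i. a (Suc i))" for t
    unfolding exp_weight_Cons simplex_exp_int_def
    using nested_int_scaleR[of m t "exp (- (a 0 * t))" "exp_weight (\<lambda>i. a (Suc i))"] by simp
  then show ?thesis unfolding simplex_exp_int_def by simp
qed

lemma simplex_exp_int_cong: "(\<And>i. i < m \<Longrightarrow> a i = a' i) \<Longrightarrow> simplex_exp_int m b a = simplex_exp_int m b a'"
  unfolding simplex_exp_int_def exp_weight_def by (rule nested_int_cong) simp

lemma image_divide_interval: "(b::real) > 0 \<Longrightarrow> (\<lambda>x. x / b) ` {0..b} = {0..1}"
proof safe
  fix x :: real assume "b > 0" "x \<in> {0..1}"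
  then show "x \<in> (\<lambda>x. x / b) ` {0..b}"
    by (intro image_eqI[of _ _ "b * x"]) (auto simp: mult_le_cancel_left1)
qed auto

text \<open>Substituting t = b u moves the dependence on the upper limit b into the integrand over
  [0, 1], where continuity in the parameters follows from continuity of the integrand.\<close>

lemma continuous_on_simplex_exp_int:
  "continuous_on (UNIV \<times> {0..}) (\<lambda>p. simplex_exp_int m (snd p) (fst p))"
proof (induction m)
  case 0
  then show ?case by simp
next
  case (Suc m)
  define h where "h a t = exp (- (a 0 * t)) * simplex_exp_int m t (\<lambda>i. a (Suc i))" for a :: "nat \<Rightarrow> real" and t
  have rescale: "simplex_exp_int (Suc m) b a = b * integral (cbox 0 1) (\<lambda>u. h a (b * u))" if "b \<ge> 0" for a b
  proof (cases "b = 0")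
    case False
    then have b: "b > 0" using that by simp
    have "integral ((\<lambda>x. x / b) ` {0..b}) (\<lambda>x. h a (b * x)) = (1 / \<bar>b\<bar>) *\<^sub>R integral {0..b} (h a)"
      using b by (intro integral_stretch_real) simp
    then show ?thesis
      using b unfolding simplex_exp_int_Suc h_def by (simp add: image_divide_interval cbox_interval)
  qed (simp add: simplex_exp_int_Suc)
  let ?S = "(UNIV \<times> {0..}) \<times> cbox (0::real) 1 :: (((nat \<Rightarrow> real) \<times> real) \<times> real) set"
  have fst_fst: "continuous_on ?S (\<lambda>x. fst (fst x))" by (intro continuous_intros)
  let ?g = "\<lambda>x::((nat \<Rightarrow> real) \<times> real) \<times> real. ((\<lambda>i. fst (fst x) (Suc i)), snd (fst x) * snd x)"
  have "continuous_on ?S ?g"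
    by (intro continuous_intros continuous_on_product_then_coordinatewise[OF fst_fst])
  moreover have "?g ` ?S \<subseteq> UNIV \<times> {0..}" by (auto simp: cbox_interval)
  ultimately have "continuous_on ?S ((\<lambda>p. simplex_exp_int m (snd p) (fst p)) \<circ> ?g)"
    by (rule continuous_on_compose[OF _ continuous_on_subset[OF Suc.IH]])
  then have "continuous_on ?S (\<lambda>x. simplex_exp_int m (snd (fst x) * snd x) (\<lambda>i. fst (fst x) (Suc i)))"
    by (simp add: o_def)
  then have "continuous_on ?S (\<lambda>(p, u). h (fst p) (snd p * u))"
    unfolding case_prod_beta' h_def
    by (intro continuous_intros continuous_on_product_then_coordinatewise[OF fst_fst])
  then have "continuous_on (UNIV \<times> {0..}) (\<lambda>p. snd p * integral (cbox 0 1) (\<lambda>u. h (fst p) (snd p * u)))"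
    by (intro continuous_intros integral_continuous_on_param)
  then show ?case by (rule continuous_on_eq) (auto simp: rescale)
qed

lemma continuous_on_simplex_exp_int_upper: "continuous_on {0..b} (\<lambda>t. simplex_exp_int m t a)"
  by (rule continuous_on_compose2[OF continuous_on_simplex_exp_int, of _ "\<lambda>t. (a, t)", simplified])
     (auto intro!: continuous_intros)

lemma nested_int_sum_exp_weight:
  fixes M :: "'x \<Rightarrow> 'v::euclidean_space"
  assumes "b \<ge> 0" and fin: "finite S"
  shows "nested_int m b (\<lambda>ts. \<Sum>x\<in>S. exp_weight (a x) ts *\<^sub>R M x) = (\<Sum>x\<in>S. simplex_exp_int m b (a x) *\<^sub>R M x)"
  using assms(1)
proof (induction m arbitrary: b a M)
  case 0
  then show ?case by (simp add: simplex_exp_int_def)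
next
  case (Suc m)
  define \<phi> where "\<phi> x t = exp (- (a x 0 * t)) * simplex_exp_int m t (\<lambda>i. a x (Suc i))" for x t
  have \<phi>_integrable: "\<phi> x integrable_on {0..b}" for x
    unfolding \<phi>_def by (intro integrable_continuous_interval continuous_intros continuous_on_simplex_exp_int_upper)
  have "nested_int m t (\<lambda>ts. \<Sum>x\<in>S. exp_weight (a x) (t # ts) *\<^sub>R M x) = (\<Sum>x\<in>S. \<phi> x t *\<^sub>R M x)"
    if "t \<in> {0..b}" for t
    using that Suc.IH[of t "\<lambda>x i. a x (Suc i)" "\<lambda>x. exp (- (a x 0 * t)) *\<^sub>R M x"]
    by (simp add: exp_weight_Cons \<phi>_def mult.commute)
  then have "nested_int (Suc m) b (\<lambda>ts. \<Sum>x\<in>S. exp_weight (a x) ts *\<^sub>R M x)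
      = integral {0..b} (\<lambda>t. \<Sum>x\<in>S. \<phi> x t *\<^sub>R M x)"
    by (simp only: nested_int.simps) (rule integral_cong)
  also have "\<dots> = (\<Sum>x\<in>S. integral {0..b} (\<lambda>t. \<phi> x t *\<^sub>R M x))"
    by (intro integral_sum fin integrable_on_scaleR_left \<phi>_integrable)
  also have "\<dots> = (\<Sum>x\<in>S. integral {0..b} (\<phi> x) *\<^sub>R M x)"
    by (intro sum.cong refl integral_unique has_integral_scaleR_left integrable_integral \<phi>_integrable)
  also have "\<dots> = (\<Sum>x\<in>S. simplex_exp_int (Suc m) b (a x) *\<^sub>R M x)"
    unfolding simplex_exp_int_Suc \<phi>_def by simp
  finally show ?case .
qed

lemma integral_exp_neg_mult:
  fixes b c :: real
  assumes b: "b \<ge> 0"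
  shows "integral {0..b} (\<lambda>t. exp (- (c * t))) = (if c = 0 then b else (1 - exp (- (c * b))) / c)"
proof (cases "c = 0")
  case False
  have "((\<lambda>t. exp (- (c * t))) has_integral (- exp (- (c * b)) / c - - exp (- (c * 0)) / c)) {0..b}"
  proof (rule fundamental_theorem_of_calculus[OF b])
    fix t assume "t \<in> {0..b}"
    have "((\<lambda>t. - exp (- (c * t)) / c) has_real_derivative exp (- (c * t))) (at t within {0..b})"
      using False by (auto intro!: derivative_eq_intros simp: field_simps)
    then show "((\<lambda>t. - exp (- (c * t)) / c) has_vector_derivative exp (- (c * t))) (at t within {0..b})"
      by (simp add: has_real_derivative_iff_has_vector_derivative)
  qed
  then show ?thesis using False by (simp add: integral_unique diff_divide_distrib)
qed (use b in simp)

definition psum :: "(nat \<Rightarrow> real) \<Rightarrow> nat \<Rightarrow> real" where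
  "psum a j = (\<Sum>i<j. a i)"

lemma psum_0 [simp]: "psum a 0 = 0"
  unfolding psum_def by simp

lemma psum_Suc_shift: "psum a (Suc j) = a 0 + psum (\<lambda>i. a (Suc i)) j"
  unfolding psum_def by (rule sum.lessThan_Suc_shift)

lemma simplex_exp_int_Suc_eq_divdiff:
  assumes IH: "\<And>t a'. t \<ge> 0 \<Longrightarrow> inj_on (psum a') {0..m} \<Longrightarrow>
      simplex_exp_int m t a' = divdiff (\<lambda>y. exp (- (t * y))) (psum a') {0..m}"
    and b: "b \<ge> 0" and inj: "inj_on (\<lambda>j. psum a (Suc j)) {0..m}"
  shows "simplex_exp_int (Suc m) b a
    = divdiff (\<lambda>y. integral {0..b} (\<lambda>t. exp (- (y * t)))) (\<lambda>j. psum a (Suc j)) {0..m}"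
proof -
  let ?a' = "\<lambda>i. a (Suc i)"
  define x where "x j = psum a (Suc j)" for j
  define P where "P j = (\<Prod>i\<in>{0..m} - {j}. (x i - x j))" for j
  have psum_shift: "psum ?a' j = x j - a 0" for j unfolding x_def by (simp add: psum_Suc_shift)
  have inj': "inj_on (psum ?a') {0..m}" using inj unfolding psum_shift x_def inj_on_def by auto
  have "simplex_exp_int m t ?a' = (\<Sum>j\<in>{0..m}. exp (- (t * (x j - a 0))) / P j)" if "t \<ge> 0" for t
    using IH[OF that inj'] by (simp add: divdiff_def psum_shift P_def)
  then have "exp (- (a 0 * t)) * simplex_exp_int m t ?a' = (\<Sum>j\<in>{0..m}. exp (- (x j * t)) / P j)"
    if "t \<in> {0..b}" for t
    using that by (simp add: sum_distrib_left exp_add[symmetric] algebra_simps)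
  then have "simplex_exp_int (Suc m) b a = integral {0..b} (\<lambda>t. \<Sum>j\<in>{0..m}. exp (- (x j * t)) / P j)"
    unfolding simplex_exp_int_Suc by (rule integral_cong)
  also have "\<dots> = (\<Sum>j\<in>{0..m}. integral {0..b} (\<lambda>t. exp (- (x j * t)) / P j))"
    by (rule integral_sum) (auto simp: divide_inverse intro!: integrable_continuous_interval continuous_intros)
  also have "\<dots> = (\<Sum>j\<in>{0..m}. integral {0..b} (\<lambda>t. exp (- (x j * t))) / P j)"
    by (simp add: integral_divide)
  finally show ?thesis unfolding divdiff_def P_def x_def .
qed

text \<open>Hermite-Genocchi formula for the exponential.\<close>

lemma simplex_exp_int_eq_divdiff:
  "b \<ge> 0 \<Longrightarrow> inj_on (psum a) {0..m} \<Longrightarrow>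
    simplex_exp_int m b a = divdiff (\<lambda>y. exp (- (b * y))) (psum a) {0..m}"
proof (induction m arbitrary: a b)
  case 0
  then show ?case by (simp add: divdiff_def)
next
  case (Suc m)
  have inj: "inj_on (psum a) (insert 0 (Suc ` {0..m}))"
    using Suc.prems(2) by (simp add: atLeast0_atMost_Suc_eq_insert_0)
  then have "inj_on (psum a) (Suc ` {0..m})" by (rule inj_on_subset) auto
  then have "inj_on (psum a \<circ> Suc) {0..m}" by (intro comp_inj_on) simp_all
  then have "inj_on (\<lambda>j. psum a (Suc j)) {0..m}" by (simp add: o_def)
  have nonzero: "psum a (Suc j) \<noteq> 0" if "j \<le> m" for j
    using inj_onD[OF inj, of "Suc j" 0] that by auto
  have "simplex_exp_int (Suc m) b a
      = divdiff (\<lambda>y. integral {0..b} (\<lambda>t. exp (- (y * t)))) (\<lambda>j. psum a (Suc j)) {0..m}"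
    by (rule simplex_exp_int_Suc_eq_divdiff[OF Suc.IH Suc.prems(1) \<open>inj_on (\<lambda>j. psum a (Suc j)) {0..m}\<close>])
  also have "\<dots> = divdiff (\<lambda>y. (exp (- (b * psum a 0)) - exp (- (b * y))) / (y - psum a 0))
      (\<lambda>j. psum a (Suc j)) {0..m}"
  proof (rule divdiff_cong[OF refl])
    fix j assume "j \<in> {0..m}"
    with nonzero integral_exp_neg_mult[OF Suc.prems(1), of "psum a (Suc j)"]
    show "integral {0..b} (\<lambda>t. exp (- (psum a (Suc j) * t)))
      = (exp (- (b * psum a 0)) - exp (- (b * psum a (Suc j)))) / (psum a (Suc j) - psum a 0)"
      by (simp add: mult.commute)
  qed
  also have "\<dots> = divdiff (\<lambda>y. (exp (- (b * psum a 0)) - exp (- (b * y))) / (y - psum a 0))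
      (psum a) (Suc ` {0..m})"
    by (subst divdiff_reindex) (simp_all add: o_def)
  also have "\<dots> = divdiff (\<lambda>y. exp (- (b * y))) (psum a) (insert 0 (Suc ` {0..m}))"
    using inj by (intro divdiff_insert[symmetric]) auto
  finally show ?case by (simp only: atLeast0_atMost_Suc_eq_insert_0)
qed

definition freq_psum :: "(nat \<Rightarrow> real) \<Rightarrow> nat \<Rightarrow> real" where
  "freq_psum w l = (\<Sum>j=1..l. w j)"

text \<open>The frequency tuple w_1, ..., w_m of the theorem, completed by -(w_1 + ... + w_m) and
  shifted to start at index 0.\<close>

definition freq_seq :: "nat \<Rightarrow> (nat \<Rightarrow> real) \<Rightarrow> nat \<Rightarrow> real" where
  "freq_seq m w i = (if i < m then w (Suc i) else - freq_psum w m)"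

definition gap_prod :: "nat \<Rightarrow> (nat \<Rightarrow> real) \<Rightarrow> nat \<Rightarrow> real" where
  "gap_prod m w p = (\<Prod>q\<in>{1..m} - {p}. (freq_psum w q - freq_psum w p))"

lemma freq_psum_0 [simp]: "freq_psum w 0 = 0"
  unfolding freq_psum_def by simp

lemma sum_Suc_eq_freq_psum: "(\<Sum>i<n. w (Suc i)) = freq_psum w n"
  unfolding freq_psum_def by (induction n) (simp_all add: sum.cl_ivl_Suc)

lemma sum_between_eq_freq_psum_diff: "q \<le> p \<Longrightarrow> (\<Sum>j=Suc q..p. w j) = freq_psum w p - freq_psum w q"
  unfolding freq_psum_def
  using sum.atLeastLessThan_concat[of 1 "Suc q" "Suc p" w] by (simp add: atLeastLessThanSuc_atLeastAtMost)

lemma inj_on_freq_psum: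
  assumes "w \<in> nondeg (Suc m)"
  shows "inj_on (freq_psum w) {0..m}"
proof -
  have ne: "freq_psum w p \<noteq> freq_psum w q" if "q < p" "p \<le> m" for p q
    using assms that sum_between_eq_freq_psum_diff[of q p w] unfolding nondeg_def by force
  show ?thesis
  proof (rule inj_onI, rule ccontr)
    fix p q assume "p \<in> {0..m}" "q \<in> {0..m}" "freq_psum w p = freq_psum w q" "p \<noteq> q"
    then show False using ne[of p q] ne[of q p] by (cases "q < p") auto
  qed
qed

lemma psum_freq_seq:
  "j \<le> m \<Longrightarrow> psum (freq_seq m w) (Suc j) = freq_psum w (if j < m then Suc j else 0)"
  unfolding psum_def freq_seq_def
  by (auto simp: sum_Suc_eq_freq_psum[symmetric] less_Suc_eq intro!: sum.cong)

text \<open>The nodes psum (freq_seq m w) (Suc j), j = 0, ..., m, are freq_psum w at 1, ..., m, 0: a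
  cyclic relabelling of the nodes freq_psum w 0, ..., freq_psum w m.\<close>

lemma simplex_exp_int_freq_seq:
  assumes nd: "w \<in> nondeg (Suc m)" and \<beta>: "\<beta> \<ge> 0"
  shows "simplex_exp_int (Suc m) \<beta> (freq_seq m w)
    = divdiff (\<lambda>y. integral {0..\<beta>} (\<lambda>t. exp (- (y * t)))) (freq_psum w) {0..m}"
proof -
  define \<sigma> where "\<sigma> j = (if j < m then Suc j else 0)" for j
  have \<sigma>_inj: "inj_on \<sigma> {0..m}" unfolding inj_on_def \<sigma>_def by auto
  have \<sigma>_image: "\<sigma> ` {0..m} = {0..m}"
  proof (intro equalityI subsetI)
    fix x assume "x \<in> {0..m}"
    then show "x \<in> \<sigma> ` {0..m}"
      by (cases x) (auto simp: \<sigma>_def intro: image_eqI[of _ _ m] image_eqI[of _ _ "x - 1"])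
  qed (auto simp: \<sigma>_def)
  have nodes: "psum (freq_seq m w) (Suc j) = (freq_psum w \<circ> \<sigma>) j" if "j \<in> {0..m}" for j
    using that by (simp add: psum_freq_seq \<sigma>_def)
  have "inj_on (freq_psum w \<circ> \<sigma>) {0..m}"
    using \<sigma>_inj \<sigma>_image inj_on_freq_psum[OF nd] by (intro comp_inj_on) simp_all
  moreover have "inj_on (\<lambda>j. psum (freq_seq m w) (Suc j)) {0..m} = inj_on (freq_psum w \<circ> \<sigma>) {0..m}"
    by (rule inj_on_cong) (rule nodes)
  ultimately have inj_nodes: "inj_on (\<lambda>j. psum (freq_seq m w) (Suc j)) {0..m}" by simp
  have "simplex_exp_int (Suc m) \<beta> (freq_seq m w)
      = divdiff (\<lambda>y. integral {0..\<beta>} (\<lambda>t. exp (- (y * t)))) (\<lambda>j. psum (freq_seq m w) (Suc j)) {0..m}"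
    by (rule simplex_exp_int_Suc_eq_divdiff[OF _ \<beta> inj_nodes]) (simp add: simplex_exp_int_eq_divdiff)
  also have "\<dots> = divdiff (\<lambda>y. integral {0..\<beta>} (\<lambda>t. exp (- (y * t)))) (freq_psum w \<circ> \<sigma>) {0..m}"
    using nodes by (intro divdiff_cong) simp_all
  also have "\<dots> = divdiff (\<lambda>y. integral {0..\<beta>} (\<lambda>t. exp (- (y * t)))) (freq_psum w) {0..m}"
    using divdiff_reindex[OF \<sigma>_inj] \<sigma>_image by simp
  finally show ?thesis .
qed

lemma gexpr_eq_gap_prod_form:
  "gexpr (Suc m) \<beta> w = (1 / (\<Prod>l=1..m. freq_psum w l)) * (\<beta> - (\<Sum>l=1..m. 1 / freq_psum w l))
     + (\<Sum>p=1..m. exp (- \<beta> * freq_psum w p) / ((freq_psum w p)\<^sup>2 * gap_prod m w p))"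
proof -
  let ?s = "freq_psum w"
  have "(-1) ^ p * exp (- \<beta> * ?s p) /
           ((\<Prod>m'=2..p. \<Sum>i=m'..p. w i) * (?s p)\<^sup>2 * (\<Prod>l=p+1..m. \<Sum>j=p+1..l. w j))
        = - (exp (- \<beta> * ?s p) / ((?s p)\<^sup>2 * gap_prod m w p))" if p: "p \<in> {1..m}" for p
  proof -
    have "Suc (p - 1) = p" using p by auto
    then have "(\<Prod>m'=2..p. \<Sum>i=m'..p. w i) = (\<Prod>q=1..p-1. \<Sum>i=Suc q..p. w i)"
      using prod.shift_bounds_cl_Suc_ivl[of "\<lambda>m'. \<Sum>i=m'..p. w i" 1 "p - 1"] by (simp add: numeral_2_eq_2)
    also have "\<dots> = (\<Prod>q=1..p-1. (?s p - ?s q))"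
      by (intro prod.cong refl sum_between_eq_freq_psum_diff) auto
    also have "\<dots> = (-1) ^ (p - 1) * (\<Prod>q=1..p-1. (?s q - ?s p))"
      using prod_uminus[of "\<lambda>q. ?s q - ?s p" "{1..p-1}"] by simp
    finally have lower: "(\<Prod>m'=2..p. \<Sum>i=m'..p. w i) = (-1) ^ (p - 1) * (\<Prod>q=1..p-1. (?s q - ?s p))" .
    have upper: "(\<Prod>l=p+1..m. \<Sum>j=p+1..l. w j) = (\<Prod>l=p+1..m. (?s l - ?s p))"
      by (intro prod.cong refl) (simp add: sum_between_eq_freq_psum_diff)
    have "{1..m} - {p} = {1..p-1} \<union> {p+1..m}" using p by auto
    then have gap: "gap_prod m w p = (\<Prod>q=1..p-1. (?s q - ?s p)) * (\<Prod>l=p+1..m. (?s l - ?s p))"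
      unfolding gap_prod_def by (simp add: prod.union_disjoint)
    have sign: "(-1::real) ^ p = - ((-1) ^ (p - 1))"
      using p by (metis Suc_diff_1 less_le_trans mult_minus1 power_Suc zero_less_one atLeastAtMost_iff)
    have sign_sq: "((-1::real) ^ (p - 1)) * ((-1) ^ (p - 1)) = 1"
      by (simp add: power_mult_distrib[symmetric])
    show ?thesis unfolding lower upper gap sign
      using sign_sq by (simp add: mult_ac minus_divide_left[symmetric])
  qed
  moreover have "gexpr (Suc m) \<beta> w = (1 / (\<Prod>l=1..m. ?s l)) * (\<beta> - (\<Sum>l=1..m. 1 / ?s l))
     - (\<Sum>p=1..m. (-1) ^ p * exp (- \<beta> * ?s p) /
           ((\<Prod>m'=2..p. \<Sum>i=m'..p. w i) * (?s p)\<^sup>2 * (\<Prod>l=p+1..m. \<Sum>j=p+1..l. w j)))"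
    unfolding gexpr_def Let_def freq_psum_def by simp
  ultimately show ?thesis by (simp add: sum_negf)
qed

lemma simplex_exp_int_eq_gexpr:
  assumes nd: "w \<in> nondeg (Suc m)" and \<beta>: "\<beta> \<ge> 0"
  shows "simplex_exp_int (Suc m) \<beta> (freq_seq m w) = gexpr (Suc m) \<beta> w"
proof -
  let ?s = "freq_psum w" and ?Q = "gap_prod m w"
  define g where "g y = integral {0..\<beta>} (\<lambda>t. exp (- (y * t)))" for y
  have insert0: "{0..m} = insert 0 {1..m}" by auto
  have inj: "inj_on ?s (insert 0 {1..m})" using inj_on_freq_psum[OF nd] unfolding insert0 .
  have s_nonzero: "?s p \<noteq> 0" if "p \<in> {1..m}" for p
    using inj_onD[OF inj, of p 0] that by auto
  have terms: "g (?s p) / (- ?s p * ?Q p)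
      = exp (- \<beta> * ?s p) / ((?s p)\<^sup>2 * ?Q p) - (1 / (?s p)^2) / ?Q p" if p: "p \<in> {1..m}" for p
  proof -
    have "?Q p \<noteq> 0"
      unfolding gap_prod_def using inj p by (intro prod_diff_nonzero) (auto simp: insert_absorb inj_on_subset)
    moreover have "g (?s p) = (1 - exp (- (?s p * \<beta>))) / ?s p"
      unfolding g_def using integral_exp_neg_mult[OF \<beta>, of "?s p"] s_nonzero[OF p] by simp
    ultimately show ?thesis
      using s_nonzero[OF p] by (simp add: field_simps power2_eq_square)
  qed
  have "simplex_exp_int (Suc m) \<beta> (freq_seq m w) = divdiff g ?s (insert 0 {1..m})"
    unfolding simplex_exp_int_freq_seq[OF nd \<beta>] g_def insert0 ..
  also have "\<dots> = g 0 / (\<Prod>l=1..m. ?s l) + (\<Sum>p=1..m. g (?s p) / (- ?s p * ?Q p))"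
    using divdiff_insert_split[of "{1..m}" 0 g ?s] by (simp add: gap_prod_def)
  also have "\<dots> = \<beta> / (\<Prod>l=1..m. ?s l)
      + ((\<Sum>p=1..m. exp (- \<beta> * ?s p) / ((?s p)\<^sup>2 * ?Q p)) - divdiff (\<lambda>y. 1 / y^2) ?s {1..m})"
    using \<beta> terms by (simp add: g_def divdiff_def gap_prod_def sum_subtractf)
  also have "divdiff (\<lambda>y. 1 / y^2) ?s {1..m} = (\<Sum>l=1..m. 1 / ?s l) / (\<Prod>l=1..m. ?s l)"
    using inj s_nonzero by (intro divdiff_inverse_square) (auto intro: inj_on_subset)
  finally show ?thesis
    unfolding gexpr_eq_gap_prod_form by (simp add: right_diff_distrib diff_divide_distrib)
qed

lemma continuous_on_freq_seq: "continuous_on UNIV (freq_seq m)"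
proof (rule continuous_on_coordinatewise_then_product)
  show "continuous_on UNIV (\<lambda>w. freq_seq m w i)" for i
    by (cases "i < m") (auto simp: freq_seq_def freq_psum_def intro!: continuous_intros)
qed

lemma continuous_on_simplex_exp_int_freq_seq:
  assumes "\<beta> \<ge> 0"
  shows "continuous_on UNIV (\<lambda>w. simplex_exp_int k \<beta> (freq_seq m w))"
proof -
  have "continuous_on UNIV ((\<lambda>p. simplex_exp_int k (snd p) (fst p)) \<circ> (\<lambda>w. (freq_seq m w, \<beta>)))"
    using assms
    by (intro continuous_on_compose continuous_on_subset[OF continuous_on_simplex_exp_int]
        continuous_intros continuous_on_freq_seq) auto
  then show ?thesis by (simp add: o_def)
qed

text \<open>Shifting all frequencies by a small c > 0 avoiding finitely many bad values makes every
  block sum nonzero, so the nondegenerate tuples are dense.\<close>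

lemma islimpt_nondeg: "w islimpt nondeg (Suc m)"
proof -
  define bad where
    "bad = (\<lambda>(a, l). - (\<Sum>j=a..l. w j) / real (l + 1 - a)) ` ({1..m} \<times> {1..m})"
  have "finite bad" unfolding bad_def by simp
  have "\<exists>c. c \<in> {0<..<inverse (real (Suc n))} \<and> c \<notin> bad" for n
    using Diff_infinite_finite[OF \<open>finite bad\<close> infinite_Ioo[of 0 "inverse (real (Suc n))"]]
    by (metis Diff_iff finite.emptyI inverse_positive_iff_positive of_nat_0_less_iff zero_less_Suc
        ex_in_conv)
  then obtain c where c: "\<And>n. c n \<in> {0<..<inverse (real (Suc n))}" "\<And>n. c n \<notin> bad" by metis
  define y where "y n = (\<lambda>i. w i + c n)" for n
  have "y n \<in> nondeg (Suc m)" for n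
    unfolding nondeg_def
  proof clarify
    fix a l assume al: "1 \<le> a" "a \<le> l" "l \<le> Suc m - 1" and "(\<Sum>j=a..l. y n j) = 0"
    moreover have "(\<Sum>j=a..l. y n j) = (\<Sum>j=a..l. w j) + real (l + 1 - a) * c n"
      unfolding y_def by (simp add: sum.distrib)
    ultimately have "c n = (\<lambda>(a, l). - (\<Sum>j=a..l. w j) / real (l + 1 - a)) (a, l)"
      by (simp add: field_simps)
    moreover have "(a, l) \<in> {1..m} \<times> {1..m}" using al by auto
    ultimately show False using c(2) unfolding bad_def by blast
  qed
  moreover have "y n \<noteq> w" for n
    using c(1)[of n] unfolding y_def by (metis add_cancel_left_right greaterThanLessThan_iff less_irrefl)
  moreover have "c \<longlonglongrightarrow> 0"
    using c(1) by (intro tendsto_sandwich[OF _ _ tendsto_const LIMSEQ_inverse_real_of_nat])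
      (auto intro!: always_eventually less_imp_le)
  then have "y \<longlonglongrightarrow> w"
    unfolding y_def
    using continuous_on_tendsto_compose[of UNIV "\<lambda>r. (\<lambda>i. w i + r)", OF _ \<open>c \<longlonglongrightarrow> 0\<close>]
    by (simp add: continuous_on_coordinatewise_then_product continuous_intros)
  ultimately show ?thesis using islimpt_sequential by blast
qed

lemma gk_eq_simplex_exp_int:
  assumes \<beta>: "\<beta> \<ge> 0"
  shows "gk (Suc m) \<beta> w = simplex_exp_int (Suc m) \<beta> (freq_seq m w)"
proof (cases "w \<in> nondeg (Suc m)")
  case True
  then show ?thesis unfolding gk_def using simplex_exp_int_eq_gexpr[OF True \<beta>] by simp
next
  case False
  let ?G = "\<lambda>w. simplex_exp_int (Suc m) \<beta> (freq_seq m w)"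
  have "(?G \<longlongrightarrow> ?G w) (at w)"
    using continuous_on_simplex_exp_int_freq_seq[OF \<beta>] by (simp add: continuous_on_def)
  then have "(?G \<longlongrightarrow> ?G w) (at w within nondeg (Suc m))"
    by (rule tendsto_within_subset) simp
  moreover have "\<forall>\<^sub>F x in at w within nondeg (Suc m). ?G x = gexpr (Suc m) \<beta> x"
    unfolding eventually_at_filter by (auto intro!: always_eventually simplex_exp_int_eq_gexpr \<beta>)
  ultimately have "(gexpr (Suc m) \<beta> \<longlongrightarrow> ?G w) (at w within nondeg (Suc m))"
    using tendsto_cong by force
  moreover have "\<not> trivial_limit (at w within nondeg (Suc m))"
    using islimpt_nondeg trivial_limit_within by blast
  ultimately show ?thesis unfolding gk_def using False tendsto_Lim by simp
qed

lemma Mk_eq_sum_balanced_words: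
  fixes H0 HI :: "complex^'n::finite^'n"
  assumes herm: "hermitian H0" and \<beta>: "\<beta> \<ge> 0"
  shows "Mk H0 HI k \<beta> = ((-1) ^ k) *\<^sub>R
    (\<Sum>ns\<in>balanced_words (bohr H0) k. simplex_exp_int k \<beta> ((!) ns) *\<^sub>R mprod (map (Dop H0 HI) ns))"
proof -
  have "finite (balanced_words (bohr H0) k)"
    unfolding balanced_words_def using finite_freq_words[OF finite_bohr[OF herm]] by simp
  moreover have "nested_int k \<beta> (\<lambda>ts. pinch H0 (mprod (map (HIt H0 HI) ts)))
      = nested_int k \<beta> (\<lambda>ts. \<Sum>ns\<in>balanced_words (bohr H0) k. exp_weight ((!) ns) ts *\<^sub>R mprod (map (Dop H0 HI) ns))"
    by (rule nested_int_cong) (simp add: pinch_mprod_HIt[OF herm] exp_weight_def)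
  ultimately show ?thesis
    unfolding Mk_def using nested_int_sum_exp_weight[OF \<beta>] by simp
qed

definition freq_list :: "nat \<Rightarrow> (nat \<Rightarrow> real) \<Rightarrow> real list" where
  "freq_list m w = map (freq_seq m w) [0..<Suc m]"

lemma length_freq_list [simp]: "length (freq_list m w) = Suc m"
  unfolding freq_list_def by simp

lemma nth_freq_list: "i < Suc m \<Longrightarrow> freq_list m w ! i = freq_seq m w i"
  unfolding freq_list_def by (simp del: upt_Suc)

lemma freq_list_eq: "freq_list m w = map w [1..<Suc m] @ [- freq_psum w m]"
proof -
  have "map (freq_seq m w) [0..<m] = map (w \<circ> Suc) [0..<m]"
    by (rule map_cong) (auto simp: freq_seq_def)
  also have "\<dots> = map w [1..<Suc m]"
    by (simp only: map_map[symmetric] map_Suc_upt) simp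
  finally show ?thesis unfolding freq_list_def by (simp add: freq_seq_def)
qed

lemma sum_list_freq_list: "sum_list (freq_list m w) = 0"
  by (simp add: freq_list_eq freq_psum_def sum_set_upt_conv_sum_list_nat[symmetric]
      atLeastLessThanSuc_atLeastAtMost del: upt_Suc)

lemma bij_betw_freq_list:
  "bij_betw (freq_list m) {w \<in> {1..m} \<rightarrow>\<^sub>E B. - freq_psum w m \<in> B} (balanced_words B (Suc m))"
proof (rule bij_betw_byWitness[where f' = "\<lambda>ns j. if j \<in> {1..m} then ns ! (j - 1) else undefined"])
  let ?T = "{w \<in> {1..m} \<rightarrow>\<^sub>E B. - freq_psum w m \<in> B}"
  let ?g = "\<lambda>ns j. if j \<in> {1..m} then ns ! (j - 1) else undefined"
  show "\<forall>w\<in>?T. ?g (freq_list m w) = w"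
  proof (intro ballI ext)
    fix w j assume "w \<in> ?T"
    then show "?g (freq_list m w) j = w j"
      by (cases "j \<in> {1..m}") (auto simp: nth_freq_list freq_seq_def PiE_def extensional_def)
  qed
  have "set (freq_list m w) \<subseteq> B" if "w \<in> ?T" for w
    using that by (auto simp: freq_list_eq PiE_def Pi_def)
  then show "freq_list m ` ?T \<subseteq> balanced_words B (Suc m)"
    by (auto simp: balanced_words_def freq_words_def sum_list_freq_list)
  have psum_g: "freq_psum (?g ns) m = (\<Sum>i<m. ns ! i)" for ns :: "real list"
    unfolding sum_Suc_eq_freq_psum[symmetric] by simp
  have words: "length ns = Suc m" "set ns \<subseteq> B" "ns ! m = - (\<Sum>i<m. ns ! i)"
    if "ns \<in> balanced_words B (Suc m)" for ns
    using that unfolding balanced_words_def freq_words_def by (auto simp: sum_list_sum_nth lessThan_atLeast0)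
  show "\<forall>ns\<in>balanced_words B (Suc m). freq_list m (?g ns) = ns"
  proof
    fix ns assume "ns \<in> balanced_words B (Suc m)"
    from words[OF this] psum_g[of ns] show "freq_list m (?g ns) = ns"
      by (intro nth_equalityI) (auto simp: nth_freq_list freq_seq_def less_Suc_eq)
  qed
  show "?g ` balanced_words B (Suc m) \<subseteq> ?T"
  proof (rule image_subsetI)
    fix ns assume "ns \<in> balanced_words B (Suc m)"
    note ns = words[OF this]
    have elem: "ns ! i \<in> B" if "i \<le> m" for i
      using ns that nth_mem by (metis in_mono less_Suc_eq_le)
    then have "?g ns \<in> {1..m} \<rightarrow>\<^sub>E B" by auto
    moreover have "- freq_psum (?g ns) m \<in> B"
      unfolding psum_g using elem[of m] ns(3) by simp
    ultimately show "?g ns \<in> ?T" by blast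
  qed
qed

lemma sum_PiE_eq_sum_balanced_words:
  assumes fin: "finite B" and vanish: "\<And>w. - freq_psum w m \<notin> B \<Longrightarrow> F (freq_list m w) = 0"
  shows "(\<Sum>w\<in>{1..m} \<rightarrow>\<^sub>E B. F (freq_list m w)) = (\<Sum>ns\<in>balanced_words B (Suc m). F ns)"
proof -
  have "(\<Sum>w\<in>{1..m} \<rightarrow>\<^sub>E B. F (freq_list m w)) = (\<Sum>w\<in>{w \<in> {1..m} \<rightarrow>\<^sub>E B. - freq_psum w m \<in> B}. F (freq_list m w))"
    using fin vanish by (intro sum.mono_neutral_right) (auto simp: finite_PiE)
  also have "\<dots> = (\<Sum>ns\<in>balanced_words B (Suc m). F ns)"
    using sum.reindex_bij_betw[OF bij_betw_freq_list] .
  finally show ?thesis .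
qed

lemma Mk_Suc_eq_sum_gk:
  fixes H0 HI :: "complex^'n::finite^'n"
  assumes herm: "hermitian H0" and \<beta>: "\<beta> \<ge> 0"
  shows "Mk H0 HI (Suc m) \<beta> = ((-1) ^ Suc m) *\<^sub>R
    (\<Sum>w\<in>{1..m} \<rightarrow>\<^sub>E bohr H0. gk (Suc m) \<beta> w *\<^sub>R
       mprod (map (\<lambda>j. Dop H0 HI (w j)) [1..<Suc m] @ [Dop H0 HI (- (\<Sum>j=1..m. w j))]))"
proof -
  let ?F = "\<lambda>ns. simplex_exp_int (Suc m) \<beta> ((!) ns) *\<^sub>R mprod (map (Dop H0 HI) ns)"
  have summand: "gk (Suc m) \<beta> w *\<^sub>R mprod (map (\<lambda>j. Dop H0 HI (w j)) [1..<Suc m] @ [Dop H0 HI (- (\<Sum>j=1..m. w j))])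
      = ?F (freq_list m w)" for w
  proof -
    have "gk (Suc m) \<beta> w = simplex_exp_int (Suc m) \<beta> ((!) (freq_list m w))"
      unfolding gk_eq_simplex_exp_int[OF \<beta>] by (rule simplex_exp_int_cong) (simp add: nth_freq_list)
    moreover have "map (\<lambda>j. Dop H0 HI (w j)) [1..<Suc m] @ [Dop H0 HI (- (\<Sum>j=1..m. w j))]
        = map (Dop H0 HI) (freq_list m w)"
      by (simp add: freq_list_eq freq_psum_def)
    ultimately show ?thesis by simp
  qed
  have vanish: "?F (freq_list m w) = 0" if "- freq_psum w m \<notin> bohr H0" for w
    using Dop_notin_bohr[OF that] by (simp add: freq_list_eq mprod_append)
  show ?thesis
    unfolding Mk_eq_sum_balanced_words[OF herm \<beta>] summand
    using sum_PiE_eq_sum_balanced_words[where F = ?F, OF finite_bohr[OF herm] vanish] by simp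
qed

theorem proposition2:
  fixes H0 HI :: "complex ^'n::finite ^'n" and \<beta> :: real and k :: nat
  assumes "hermitian H0" and "hermitian HI" and "\<beta> > 0" and "k \<ge> 1"
  shows "Mk H0 HI k \<beta> = ((-1) ^ k) *\<^sub>R
           (\<Sum>\<omega>\<in>{1..k-1} \<rightarrow>\<^sub>E bohr H0.
              gk k \<beta> \<omega> *\<^sub>R
              mprod (map (\<lambda>j. Dop H0 HI (\<omega> j)) [1..<k] @ [Dop H0 HI (- (\<Sum>j=1..k-1. \<omega> j))]))
         \<and> Mk H0 HI 1 \<beta> = (- \<beta>) *\<^sub>R Dop H0 HI 0"
proof
  have \<beta>: "\<beta> \<ge> 0" using assms(3) by simp
  obtain m where k: "k = Suc m" using assms(4) by (cases k) auto
  show "Mk H0 HI k \<beta> = ((-1) ^ k) *\<^sub>R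
           (\<Sum>\<omega>\<in>{1..k-1} \<rightarrow>\<^sub>E bohr H0.
              gk k \<beta> \<omega> *\<^sub>R
              mprod (map (\<lambda>j. Dop H0 HI (\<omega> j)) [1..<k] @ [Dop H0 HI (- (\<Sum>j=1..k-1. \<omega> j))]))"
    unfolding k using Mk_Suc_eq_sum_gk[OF assms(1) \<beta>] by simp
  have "gk 1 \<beta> w = \<beta>" for w
    unfolding gk_def nondeg_def gexpr_def by simp
  then show "Mk H0 HI 1 \<beta> = (- \<beta>) *\<^sub>R Dop H0 HI 0"
    using Mk_Suc_eq_sum_gk[OF assms(1) \<beta>, of HI 0] by simp
qed

end
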